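(* Let $A=(a_{ij})_{i,j=1}^{3}$ be a real symmetric invertible $3\times 3$ matrix, and on $\mathbb{R}^3$ with coordinates $(u,v,w)$ let $$f=\tfrac12\left(a_{11}u^2+a_{22}v^2+a_{33}w^2+2a_{12}uv+2a_{13}uw+2a_{23}vw\right),\qquad f_i=a_{i1}u+a_{i2}v+a_{i3}w\quad(i=1,2,3).$$ Then the vector fields $X_1,X_2,X_3$ given by $$(X_1,X_2,X_3)=\Bigl(\frac{\partial}{\partial u},\frac{\partial}{\partial v},\frac{\partial}{\partial w}\Bigr)\cdot\begin{pmatrix}0&-f_3&f_2\\ f_3&0&-f_1\\ -f_2&f_1&0\end{pmatrix},$$ that is, $$X_1=f_3\frac{\partial}{\partial v}-f_2\frac{\partial}{\partial w},\qquad X_2=-f_3\frac{\partial}{\partial u}+f_1\frac{\partial}{\partial w},\qquad X_3=f_2\frac{\partial}{\partial u}-f_1\frac{\partial}{\partial v},$$ are fundamental vector fields of a 3-dimensional Lie group $G$, and their commutators are $$[X_1,X_2]=\sum_{k=1}^3a_{3k}X_k,\qquad [X_2,X_3]=\sum_{k=1}^3a_{1k}X_k,\qquad [X_3,X_1]=\sum_{k=1}^3a_{2k}X_k .$$ These fundamental vector fields are (linearly) dependent, $$f_1X_1+f_2X_2+f_3X_3=0,$$ and the family of quadrics $f=\mathrm{const}$ are orbits of the group $G$.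
   Context: The commutator of vector fields is $[X,Y]=X\circ Y-Y\circ X$, with vector fields regarded as derivations on functions. The fundamental vector fields of a Lie group $G$ acting on $\mathbb{R}^3$ are the vector fields whose flows are the actions of one-parameter subgroups of $G$; here $X_1,X_2,X_3$ correspond to a basis of the Lie algebra of $G$. "Linearly dependent" refers to linear dependence with functions as coefficients.
   Formalization: The claim that the quadrics f = const are orbits is stated for nonempty quadrics with const ≠ 0; the quadric f = 0 is split into the orbits {0} and, if nonempty, its nonzero points, since the origin is fixed by G and a cone f = 0 is therefore not a single orbit. *)

theory Defs
  imports "HOL-Analysis.Analysis" "HOL-Algebra.Group_Action"
begin

section \<open>Smooth manifolds\<close>

text \<open>The definition is meant for open sets \<open>S\<close> only, since the derivatives are taken at points,
  not within \<open>S\<close>.\<close>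

fun k_times_differentiable_on ::
  "nat \<Rightarrow> 'a::real_normed_vector set \<Rightarrow> ('a \<Rightarrow> 'b::real_normed_vector) \<Rightarrow> bool" where
  "k_times_differentiable_on 0 S f \<longleftrightarrow> continuous_on S f"
| "k_times_differentiable_on (Suc k) S f \<longleftrightarrow>
     (\<forall>x\<in>S. f differentiable (at x)) \<and>
     (\<forall>v. k_times_differentiable_on k S (\<lambda>x. frechet_derivative f (at x) v))"

definition smooth_on :: "'a::real_normed_vector set \<Rightarrow> ('a \<Rightarrow> 'b::real_normed_vector) \<Rightarrow> bool" where
  "smooth_on S f \<longleftrightarrow> (\<forall>k. k_times_differentiable_on k S f)"

text \<open>A chart is a pair of its domain and its coordinate map into the model space \<open>'e\<close>; a manifold
  with model space \<open>'e\<close> has dimension \<open>DIM('e)\<close>. The set of charts is an arbitrary smooth atlas,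
  not necessarily a maximal one.\<close>

record ('a, 'e) manifold =
  mtop :: "'a topology"
  charts :: "('a set \<times> ('a \<Rightarrow> 'e)) set"

definition smooth_manifold :: "('a, 'e::euclidean_space) manifold \<Rightarrow> bool" where
  "smooth_manifold M \<longleftrightarrow>
     Hausdorff_space (mtop M) \<and> second_countable (mtop M) \<and>
     (\<Union>(U, \<phi>)\<in>charts M. U) = topspace (mtop M) \<and>
     (\<forall>(U, \<phi>)\<in>charts M. openin (mtop M) U \<and> open (\<phi> ` U) \<and>
        homeomorphic_map (subtopology (mtop M) U) (top_of_set (\<phi> ` U)) \<phi>) \<and>
     (\<forall>(U, \<phi>)\<in>charts M. \<forall>(V, \<psi>)\<in>charts M.
        smooth_on (\<phi> ` (U \<inter> V)) (\<psi> \<circ> inv_into U \<phi>))"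

definition smooth_map ::
  "('a, 'e::euclidean_space) manifold \<Rightarrow> ('b, 'f::euclidean_space) manifold \<Rightarrow> ('a \<Rightarrow> 'b) \<Rightarrow> bool" where
  "smooth_map M N f \<longleftrightarrow> continuous_map (mtop M) (mtop N) f \<and>
     (\<forall>(U, \<phi>)\<in>charts M. \<forall>(V, \<psi>)\<in>charts N.
        smooth_on (\<phi> ` (U \<inter> f -` V)) (\<psi> \<circ> f \<circ> inv_into U \<phi>))"

definition prod_manifold ::
  "('a, 'e::euclidean_space) manifold \<Rightarrow> ('b, 'f::euclidean_space) manifold \<Rightarrow> ('a \<times> 'b, 'e \<times> 'f) manifold" where
  "prod_manifold M N = \<lparr> mtop = prod_topology (mtop M) (mtop N),
     charts = {(U \<times> V, map_prod \<phi> \<psi>) | U \<phi> V \<psi>. (U, \<phi>) \<in> charts M \<and> (V, \<psi>) \<in> charts N} \<rparr>"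

definition euclidean_manifold :: "('e::euclidean_space, 'e) manifold" where
  "euclidean_manifold = \<lparr> mtop = euclidean, charts = {(UNIV, \<lambda>x. x)} \<rparr>"


section \<open>Lie groups, smooth actions and fundamental vector fields\<close>

definition lie_group :: "'g monoid \<Rightarrow> ('g, 'e::euclidean_space) manifold \<Rightarrow> bool" where
  "lie_group G M \<longleftrightarrow> group G \<and> smooth_manifold M \<and> topspace (mtop M) = carrier G \<and>
     smooth_map (prod_manifold M M) M (\<lambda>(g, h). g \<otimes>\<^bsub>G\<^esub> h) \<and>
     smooth_map M M (\<lambda>g. inv\<^bsub>G\<^esub> g)"

definition smooth_action ::
  "'g monoid \<Rightarrow> ('g, 'e::euclidean_space) manifold \<Rightarrow> ('g \<Rightarrow> 'v \<Rightarrow> 'v::euclidean_space) \<Rightarrow> bool" where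
  "smooth_action G M \<rho> \<longleftrightarrow> group_action G UNIV \<rho> \<and>
     smooth_map (prod_manifold M euclidean_manifold) euclidean_manifold (\<lambda>(g, p). \<rho> g p)"

definition one_parameter_subgroup ::
  "'g monoid \<Rightarrow> ('g, 'e::euclidean_space) manifold \<Rightarrow> (real \<Rightarrow> 'g) \<Rightarrow> bool" where
  "one_parameter_subgroup G M \<gamma> \<longleftrightarrow> smooth_map euclidean_manifold M \<gamma> \<and>
     (\<forall>t. \<gamma> t \<in> carrier G) \<and> (\<forall>s t. \<gamma> (s + t) = \<gamma> s \<otimes>\<^bsub>G\<^esub> \<gamma> t)"

text \<open>The Lie algebra is the tangent space at the identity, and a one-parameter subgroup \<open>\<gamma>\<close>
  corresponds to its element \<open>\<gamma>'(0)\<close>. A chart around the identity identifies the tangent space with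
  the model space. The basis property does not depend on the chart, because the derivatives of
  the transition maps are linear isomorphisms.\<close>

definition lie_algebra_basis ::
  "'g monoid \<Rightarrow> ('g, 'e::euclidean_space) manifold \<Rightarrow> ('i \<Rightarrow> real \<Rightarrow> 'g) \<Rightarrow> bool" where
  "lie_algebra_basis G M \<gamma> \<longleftrightarrow> (\<forall>i. one_parameter_subgroup G M (\<gamma> i)) \<and>
     (\<forall>(U, \<phi>)\<in>charts M. \<one>\<^bsub>G\<^esub> \<in> U \<longrightarrow>
        (let v = (\<lambda>i. vector_derivative (\<phi> \<circ> \<gamma> i) (at 0))
         in inj v \<and> independent (range v) \<and> span (range v) = UNIV))"

text \<open>A vector field on \<open>'v\<close> is given by its coefficient function.\<close>

definition is_flow_of :: "(real \<Rightarrow> 'v \<Rightarrow> 'v) \<Rightarrow> ('v \<Rightarrow> 'v::euclidean_space) \<Rightarrow> bool" where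
  "is_flow_of \<Phi> X \<longleftrightarrow> (\<forall>p. \<Phi> 0 p = p) \<and>
     (\<forall>p t. ((\<lambda>s. \<Phi> s p) has_vector_derivative X (\<Phi> t p)) (at t))"

definition fundamental_vector_field ::
  "('g \<Rightarrow> 'v \<Rightarrow> 'v) \<Rightarrow> (real \<Rightarrow> 'g) \<Rightarrow> ('v \<Rightarrow> 'v::euclidean_space) \<Rightarrow> bool" where
  "fundamental_vector_field \<rho> \<gamma> X \<longleftrightarrow> is_flow_of (\<lambda>t. \<rho> (\<gamma> t)) X"


section \<open>Vector fields as derivations\<close>

definition derivation :: "('v \<Rightarrow> 'v::euclidean_space) \<Rightarrow> ('v \<Rightarrow> real) \<Rightarrow> ('v \<Rightarrow> real)" where
  "derivation X g = (\<lambda>p. frechet_derivative g (at p) (X p))"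

definition commutator ::
  "('v \<Rightarrow> 'v::euclidean_space) \<Rightarrow> ('v \<Rightarrow> 'v) \<Rightarrow> ('v \<Rightarrow> real) \<Rightarrow> ('v \<Rightarrow> real)" where
  "commutator X Y g = (\<lambda>p. derivation X (derivation Y g) p - derivation Y (derivation X g) p)"

definition dependent_over_functions :: "('i::finite \<Rightarrow> 'v \<Rightarrow> 'v::euclidean_space) \<Rightarrow> bool" where
  "dependent_over_functions X \<longleftrightarrow>
     (\<exists>c :: 'i \<Rightarrow> 'v \<Rightarrow> real. (\<forall>i. smooth_on UNIV (c i)) \<and> (\<exists>i p. c i p \<noteq> 0) \<and>
        (\<forall>p. (\<Sum>i\<in>UNIV. c i p *\<^sub>R X i p) = 0))"


section \<open>The quadratic form and the vector fields\<close>

text \<open>A point \<open>p\<close> has the coordinates \<open>u = p $ 1\<close>, \<open>v = p $ 2\<close>, \<open>w = p $ 3\<close>.\<close>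

definition quad :: "real^3^3 \<Rightarrow> real^3 \<Rightarrow> real" where
  "quad A p = (A$1$1 * (p$1)\<^sup>2 + A$2$2 * (p$2)\<^sup>2 + A$3$3 * (p$3)\<^sup>2
     + 2 * A$1$2 * p$1 * p$2 + 2 * A$1$3 * p$1 * p$3 + 2 * A$2$3 * p$2 * p$3) / 2"

definition lin :: "real^3^3 \<Rightarrow> 3 \<Rightarrow> real^3 \<Rightarrow> real" where
  "lin A i p = A$i$1 * p$1 + A$i$2 * p$2 + A$i$3 * p$3"

definition coeff_matrix :: "real^3^3 \<Rightarrow> real^3 \<Rightarrow> real^3^3" where
  "coeff_matrix A p = vector
     [vector [0, - lin A 3 p, lin A 2 p],
      vector [lin A 3 p, 0, - lin A 1 p],
      vector [- lin A 2 p, lin A 1 p, 0]]"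

definition quadric_field :: "real^3^3 \<Rightarrow> 3 \<Rightarrow> real^3 \<Rightarrow> real^3" where
  "quadric_field A j p = column j (coeff_matrix A p)"

lemma quadric_field_explicit:
  "quadric_field A 1 p = vector [0, lin A 3 p, - lin A 2 p]"
  "quadric_field A 2 p = vector [- lin A 3 p, 0, lin A 1 p]"
  "quadric_field A 3 p = vector [lin A 2 p, - lin A 1 p, 0]"
  by (simp_all add: quadric_field_def coeff_matrix_def column_def vec_eq_iff forall_3)

end

theory Submission
  imports Defs
begin

text \<open>The group is the full isometry group \<open>G = {g. g\<^sup>T A g = A}\<close> of the form \<open>A\<close>, acting linearly;
  its identity component would not do, since it does not exchange the two sheets of a hyperboloid.
  Cayley transforms, translated by the elements of \<open>G\<close>, provide the charts. The field \<open>X\<^sub>i\<close> is the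
  linear field \<open>p \<mapsto> S\<^sub>i A p\<close> with \<open>S\<^sub>i\<close> skew-symmetric, so that \<open>S\<^sub>i A\<close> is an infinitesimal isometry, and
  \<open>(S\<^sub>i A)\<^sup>3\<close> is a multiple of \<open>S\<^sub>i A\<close> by Cayley-Hamilton, which gives the flow in closed form. Reflections
  show that \<open>G\<close> is transitive on the nonzero vectors of each level set, and the commutators reduce to
  matrix commutators by the symmetry of second derivatives.\<close>

section \<open>Calculus of smooth functions\<close>

text \<open>The signature of \<open>A\<close> is arbitrary, so no step may rely on compactness or on
  positive lengths; the signature only influences whether a flow is trigonometric, parabolic or
  hyperbolic. The Lie algebra consists of the \<open>X\<close> with
  \<open>A ** X + transpose X ** A = 0\<close>, and for symmetric invertible \<open>A\<close> this
  says that \<open>X ** matrix_inv A\<close> is skew. Hence \<open>skew s ** A\<close>, with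
  \<open>s\<close> in R^3, runs through the Lie algebra exactly once: the group has dimension 3, and
  the fields X_i, which belong to the axis vectors, come from a basis. The Cayley transform is
  preferable to the exponential map because it and its inverse are rational: smoothness of the
  charts reduces to that of matrix inversion, and by Cramer's rule to that of determinants. It is
  undefined at matrices with eigenvalue -1, which is what forces the translates.\<close>

lemma has_derivative_frechet:
  "f differentiable at x \<Longrightarrow> (f has_derivative frechet_derivative f (at x)) (at x)"
  by (simp add: frechet_derivative_works)

lemma frechet_derivative_eqI:
  "(f has_derivative f') (at x) \<Longrightarrow> frechet_derivative f (at x) = f'"
  by (metis frechet_derivative_at)

text \<open>On an open set the functions agree near every point, hence have the same derivative
  there; the induction then passes to the derivatives, which are compared on the set only.\<close>

lemma k_times_differentiable_on_cong:
  assumes "open S" "\<And>x. x \<in> S \<Longrightarrow> f x = g x" "k_times_differentiable_on k S f"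
  shows "k_times_differentiable_on k S g"
  using assms(2,3)
proof (induction k arbitrary: f g)
  case 0
  then show ?case by (simp cong: continuous_on_cong)
next
  case (Suc k)
  have D: "(g has_derivative frechet_derivative f (at x)) (at x)" if "x \<in> S" for x
    using Suc.prems that assms(1)
    by (intro has_derivative_transform_within_open[OF has_derivative_frechet]) auto
  have "k_times_differentiable_on k S (\<lambda>x. frechet_derivative g (at x) v)" for v
  proof (rule Suc.IH)
    show "k_times_differentiable_on k S (\<lambda>x. frechet_derivative f (at x) v)"
      using Suc.prems(2) by simp
  qed (simp add: frechet_derivative_eqI[OF D])
  then show ?case using D by (auto simp: differentiable_def)
qed

text \<open>Lets a concrete formula for the derivative, valid on \<open>S\<close>, stand in for
  \<open>frechet_derivative\<close>; the inductions for sums, products, compositions and inverses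
  rest on it.\<close>

lemma k_times_differentiable_on_SucI:
  assumes "open S" "\<And>x. x \<in> S \<Longrightarrow> (f has_derivative f' x) (at x)"
    "\<And>v. k_times_differentiable_on k S (\<lambda>x. f' x v)"
  shows "k_times_differentiable_on (Suc k) S f"
proof -
  have "k_times_differentiable_on k S (\<lambda>x. frechet_derivative f (at x) v)" for v
    by (rule k_times_differentiable_on_cong[OF assms(1) _ assms(3)[of v]])
      (simp add: frechet_derivative_eqI[OF assms(2)])
  then show ?thesis using assms(2) by (auto simp: differentiable_def)
qed

lemma k_times_differentiable_on_imp_continuous_on:
  "k_times_differentiable_on k S f \<Longrightarrow> continuous_on S f"
  by (cases k) (auto intro: continuous_at_imp_continuous_on differentiable_imp_continuous_within)

lemma k_times_differentiable_on_SucD: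
  "k_times_differentiable_on (Suc k) S f \<Longrightarrow> k_times_differentiable_on k S f"
  by (induction k arbitrary: f)
    (auto intro: continuous_at_imp_continuous_on differentiable_imp_continuous_within)

lemma k_times_differentiable_on_subset:
  "k_times_differentiable_on k S f \<Longrightarrow> T \<subseteq> S \<Longrightarrow> k_times_differentiable_on k T f"
  by (induction k arbitrary: f) (auto intro: continuous_on_subset)

lemma k_times_differentiable_on_const: "k_times_differentiable_on k S (\<lambda>x. c)"
  by (induction k arbitrary: c) auto

lemma k_times_differentiable_on_linear:
  assumes "bounded_linear f" shows "k_times_differentiable_on k S f"
proof (cases k)
  case 0
  then show ?thesis using assms by (simp add: linear_continuous_on)
next
  case (Suc m)
  have "(f has_derivative f) (at x)" for x
    using assms by (rule bounded_linear_imp_has_derivative)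
  then have "f differentiable at x" "frechet_derivative f (at x) = f" for x
    by (auto simp: differentiable_def frechet_derivative_eqI)
  then show ?thesis by (simp add: Suc k_times_differentiable_on_const)
qed

lemma k_times_differentiable_on_add:
  assumes "open S" "k_times_differentiable_on k S f" "k_times_differentiable_on k S g"
  shows "k_times_differentiable_on k S (\<lambda>x. f x + g x)"
  using assms(2,3)
proof (induction k arbitrary: f g)
  case 0
  then show ?case by (auto intro: continuous_on_add)
next
  case (Suc k)
  then show ?case
    by (intro k_times_differentiable_on_SucI[OF assms(1)
          has_derivative_add[OF has_derivative_frechet has_derivative_frechet]]) auto
qed

lemma k_times_differentiable_on_sum:
  assumes "open S" "\<And>i. i \<in> I \<Longrightarrow> k_times_differentiable_on k S (f i)"
  shows "k_times_differentiable_on k S (\<lambda>x. \<Sum>i\<in>I. f i x)"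
  using assms(2)
  by (induction I rule: infinite_finite_induct)
    (auto intro: k_times_differentiable_on_add[OF assms(1)] k_times_differentiable_on_const)

lemma k_times_differentiable_on_bilinear:
  assumes "open S" "bounded_bilinear B"
    "k_times_differentiable_on k S f" "k_times_differentiable_on k S g"
  shows "k_times_differentiable_on k S (\<lambda>x. B (f x) (g x))"
  using assms(3,4)
proof (induction k arbitrary: f g)
  case 0
  then show ?case by (auto intro: bounded_bilinear.continuous_on[OF assms(2)])
next
  case (Suc k)
  \<comment> \<open>The product rule leaves one factor undifferentiated in each summand, so both
    factors are needed at the lower order too.\<close>
  note Suc.prems[THEN k_times_differentiable_on_SucD]
  with Suc show ?case
    by (intro k_times_differentiable_on_SucI[OF assms(1)
          bounded_bilinear.FDERIV[OF assms(2) has_derivative_frechet has_derivative_frechet]]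
        k_times_differentiable_on_add[OF assms(1)]) auto
qed

text \<open>The chain rule, with the outer derivative expanded in a basis so that it becomes a sum of
  products of functions of one lower order.\<close>

lemma k_times_differentiable_on_compose:
  fixes f :: "'a::real_normed_vector \<Rightarrow> 'b::euclidean_space"
  assumes "open S" "open T" "f ` S \<subseteq> T"
    "k_times_differentiable_on k T g" "k_times_differentiable_on k S f"
  shows "k_times_differentiable_on k S (\<lambda>x. g (f x))"
  using assms(4,5)
proof (induction k arbitrary: g)
  case 0
  then show ?case using assms(3) by (auto intro: continuous_on_compose2)
next
  case (Suc k)
  let ?f' = "\<lambda>x. frechet_derivative f (at x)" and ?g' = "\<lambda>y. frechet_derivative g (at y)"
  have "((\<lambda>x. g (f x)) has_derivative (\<lambda>v. \<Sum>b\<in>Basis. (?f' x v \<bullet> b) *\<^sub>R ?g' (f x) b)) (at x)"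
    if "x \<in> S" for x
  proof -
    have f: "(f has_derivative ?f' x) (at x)" and g: "(g has_derivative ?g' (f x)) (at (f x))"
      using Suc.prems that assms(3) by (auto intro!: has_derivative_frechet)
    interpret g: bounded_linear "?g' (f x)" using g by (rule has_derivative_bounded_linear)
    have expand: "?g' (f x) w = (\<Sum>b\<in>Basis. (w \<bullet> b) *\<^sub>R ?g' (f x) b)" for w
      using g.sum[of "\<lambda>b. (w \<bullet> b) *\<^sub>R b" Basis] by (simp only: euclidean_representation g.scaleR)
    show ?thesis using has_derivative_compose[OF f g] by (simp only: expand[symmetric])
  qed
  moreover have "k_times_differentiable_on k S (\<lambda>x. (?f' x v \<bullet> b) *\<^sub>R ?g' (f x) b)" for v b
    using Suc.prems k_times_differentiable_on_SucD[OF Suc.prems(2)]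
    by (intro k_times_differentiable_on_bilinear[OF assms(1) bounded_bilinear_scaleR]
        k_times_differentiable_on_bilinear[OF assms(1) bounded_bilinear_inner]
        k_times_differentiable_on_const Suc.IH) auto
  ultimately show ?case
    by (rule k_times_differentiable_on_SucI[OF assms(1) _ k_times_differentiable_on_sum[OF assms(1)]])
qed

lemma smooth_on_cong:
  "open S \<Longrightarrow> (\<And>x. x \<in> S \<Longrightarrow> f x = g x) \<Longrightarrow> smooth_on S f \<Longrightarrow> smooth_on S g"
  unfolding smooth_on_def using k_times_differentiable_on_cong by metis

lemma smooth_on_imp_continuous_on: "smooth_on S f \<Longrightarrow> continuous_on S f"
  by (auto simp: smooth_on_def intro: k_times_differentiable_on_imp_continuous_on)

lemma smooth_on_imp_differentiable: "smooth_on S f \<Longrightarrow> x \<in> S \<Longrightarrow> f differentiable at x"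
  unfolding smooth_on_def by (metis k_times_differentiable_on.simps(2))

lemma smooth_on_derivative: "smooth_on S f \<Longrightarrow> smooth_on S (\<lambda>x. frechet_derivative f (at x) v)"
  unfolding smooth_on_def by (metis k_times_differentiable_on.simps(2))

lemma smooth_on_subset: "smooth_on S f \<Longrightarrow> T \<subseteq> S \<Longrightarrow> smooth_on T f"
  by (auto simp: smooth_on_def intro: k_times_differentiable_on_subset)

lemma smooth_on_const: "smooth_on S (\<lambda>x. c)"
  by (simp add: smooth_on_def k_times_differentiable_on_const)

lemma smooth_on_linear: "bounded_linear f \<Longrightarrow> smooth_on S f"
  by (simp add: smooth_on_def k_times_differentiable_on_linear)

lemma smooth_on_add: "open S \<Longrightarrow> smooth_on S f \<Longrightarrow> smooth_on S g \<Longrightarrow> smooth_on S (\<lambda>x. f x + g x)"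
  by (simp add: smooth_on_def k_times_differentiable_on_add)

lemma smooth_on_sum:
  "open S \<Longrightarrow> (\<And>i. i \<in> I \<Longrightarrow> smooth_on S (f i)) \<Longrightarrow> smooth_on S (\<lambda>x. \<Sum>i\<in>I. f i x)"
  by (simp add: smooth_on_def k_times_differentiable_on_sum)

lemma smooth_on_bilinear:
  "open S \<Longrightarrow> bounded_bilinear B \<Longrightarrow> smooth_on S f \<Longrightarrow> smooth_on S g \<Longrightarrow> smooth_on S (\<lambda>x. B (f x) (g x))"
  by (simp add: smooth_on_def k_times_differentiable_on_bilinear)

lemmas smooth_on_mult =
  smooth_on_bilinear[OF _ bounded_bilinear_mult]

lemma smooth_on_compose:
  fixes f :: "'a::real_normed_vector \<Rightarrow> 'b::euclidean_space"
  assumes "open S" "open T" "smooth_on T g" "smooth_on S f" "f ` S \<subseteq> T"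
  shows "smooth_on S (\<lambda>x. g (f x))"
  using assms unfolding smooth_on_def by (blast intro: k_times_differentiable_on_compose)

lemma smooth_on_linear_compose:
  fixes f :: "'a::real_normed_vector \<Rightarrow> 'b::euclidean_space"
  shows "open S \<Longrightarrow> bounded_linear g \<Longrightarrow> smooth_on S f \<Longrightarrow> smooth_on S (\<lambda>x. g (f x))"
  by (rule smooth_on_compose[of S UNIV]) (auto intro: smooth_on_linear)

lemma smooth_on_diff:
  fixes f :: "'a::real_normed_vector \<Rightarrow> 'b::euclidean_space"
  assumes "open S" "smooth_on S f" "smooth_on S g" shows "smooth_on S (\<lambda>x. f x - g x)"
  using smooth_on_add[OF assms(1,2) smooth_on_linear_compose[OF assms(1)
        bounded_linear_minus[OF bounded_linear_ident] assms(3)]] by simp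

lemma smooth_on_prod:
  fixes f :: "'i \<Rightarrow> 'a::real_normed_vector \<Rightarrow> real"
  assumes "open S" "\<And>i. i \<in> I \<Longrightarrow> smooth_on S (f i)"
  shows "smooth_on S (\<lambda>x. \<Prod>i\<in>I. f i x)"
  using assms(2)
  by (induction I rule: infinite_finite_induct) (auto intro: smooth_on_mult[OF assms(1)] smooth_on_const)

text \<open>The function is the sum of its coordinates placed on the axes. Two applications treat a
  matrix entry by entry.\<close>

lemma smooth_on_vec:
  fixes f :: "'a::real_normed_vector \<Rightarrow> 'b::euclidean_space^'n"
  assumes "open S" "\<And>i. smooth_on S (\<lambda>x. f x $ i)"
  shows "smooth_on S f"
proof -
  have "smooth_on S (\<lambda>x. \<Sum>i\<in>UNIV. axis i (f x $ i))"
  proof (intro smooth_on_sum[OF assms(1)] smooth_on_linear_compose[OF assms(1) _ assms(2)])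
    show "bounded_linear (axis i :: 'b \<Rightarrow> 'b^'n)" for i
      by (rule linear_conv_bounded_linear[THEN iffD1], rule linearI)
        (auto simp: axis_def vec_eq_iff)
  qed
  moreover have "(\<Sum>i\<in>UNIV. axis i (f x $ i)) = f x" for x
    by (simp add: vec_eq_iff axis_def if_distrib[of "\<lambda>a. _ $ a"] cong: if_cong)
  ultimately show ?thesis by simp
qed

lemma smooth_on_nth:
  fixes f :: "'a::real_normed_vector \<Rightarrow> 'b::euclidean_space^'n"
  shows "open S \<Longrightarrow> smooth_on S f \<Longrightarrow> smooth_on S (\<lambda>x. f x $ i)"
  by (rule smooth_on_linear_compose) (auto intro: bounded_linear_vec_nth)

lemma smooth_on_Pair:
  fixes f :: "'a::real_normed_vector \<Rightarrow> 'b::euclidean_space"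
    and g :: "'a \<Rightarrow> 'c::euclidean_space"
  assumes "open S" "smooth_on S f" "smooth_on S g"
  shows "smooth_on S (\<lambda>x. (f x, g x))"
proof -
  have "smooth_on S (\<lambda>x. (f x, 0) + (0, g x))"
    using assms
    by (intro smooth_on_add smooth_on_linear_compose[of S "\<lambda>y. (y, 0)"]
        smooth_on_linear_compose[of S "\<lambda>y. (0, y)"])
      (auto intro!: bounded_linear_Pair bounded_linear_ident bounded_linear_zero)
  then show ?thesis by simp
qed

text \<open>The derivative is again a product of inverses, so order \<open>k\<close> of the inverse
  yields order \<open>k + 1\<close>.\<close>

lemma smooth_on_inverse: "smooth_on (- {0}) (inverse :: real \<Rightarrow> real)"
proof -
  have "k_times_differentiable_on k (- {0}) (inverse :: real \<Rightarrow> real)" for k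
  proof (induction k)
    case 0
    then show ?case by (auto intro: continuous_intros)
  next
    case (Suc k)
    note * = k_times_differentiable_on_bilinear[OF _ bounded_bilinear_mult]
    show ?case
    proof (rule k_times_differentiable_on_SucI)
      show "(inverse has_derivative (\<lambda>v. - (inverse x * v * inverse x))) (at x)"
        if "x \<in> - {0}" for x :: real
        using that by (auto intro: has_derivative_inverse')
      show "k_times_differentiable_on k (- {0}) (\<lambda>x. - (inverse x * v * inverse x))" for v :: real
        using *[OF _ *[OF _ k_times_differentiable_on_const[of k _ "- v"] Suc] Suc]
        by (simp add: mult_ac open_Compl)
    qed (simp add: open_Compl)
  qed
  then show ?thesis by (simp add: smooth_on_def)
qed

lemma smooth_on_real_inverse:
  fixes f :: "'a::real_normed_vector \<Rightarrow> real"
  assumes "open S" "smooth_on S f" "\<And>x. x \<in> S \<Longrightarrow> f x \<noteq> 0"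
  shows "smooth_on S (\<lambda>x. inverse (f x))"
  using assms by (intro smooth_on_compose[OF _ _ smooth_on_inverse]) auto

section \<open>Smoothness of determinants and of matrix inversion\<close>

lemma smooth_on_det:
  fixes M :: "'a::real_normed_vector \<Rightarrow> real^'n^'n"
  assumes "open S" "smooth_on S M" shows "smooth_on S (\<lambda>x. det (M x))"
  unfolding det_def using assms
  by (intro smooth_on_sum smooth_on_mult smooth_on_prod smooth_on_const smooth_on_nth)

lemma bounded_bilinear_matrix_matrix_mult:
  "bounded_bilinear ((**) :: real^'n^'m \<Rightarrow> real^'k^'n \<Rightarrow> real^'k^'m)"
  unfolding bilinear_conv_bounded_bilinear[symmetric] bilinear_def linear_iff matrix_matrix_mult_def
  by (auto simp: vec_eq_iff sum.distrib algebra_simps sum_distrib_left)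

lemma bounded_bilinear_matrix_vector_mult:
  "bounded_bilinear ((*v) :: real^'n^'m \<Rightarrow> real^'n \<Rightarrow> real^'m)"
  unfolding bilinear_conv_bounded_bilinear[symmetric] bilinear_def linear_iff matrix_vector_mult_def
  by (auto simp: vec_eq_iff sum.distrib algebra_simps sum_distrib_left)

lemmas smooth_on_matrix_mult = smooth_on_bilinear[OF _ bounded_bilinear_matrix_matrix_mult]

lemmas smooth_on_matrix_vector_mult = smooth_on_bilinear[OF _ bounded_bilinear_matrix_vector_mult]

lemma matrix_inv:
  assumes "invertible A"
  shows "A ** matrix_inv A = mat 1" "matrix_inv A ** A = mat 1"
  using someI_ex[OF assms[unfolded invertible_def]] by (auto simp: matrix_inv_def)

text \<open>Column \<open>l\<close> of the inverse solves \<open>A *v y = axis l 1\<close>; Cramer's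
  rule turns its entries into quotients of determinants, a form whose smoothness is visible.\<close>

lemma matrix_inv_cramer:
  fixes A :: "real^'n^'n"
  assumes "det A \<noteq> 0"
  shows "matrix_inv A $ k $ l = det (\<chi> i j. if j = k then axis l 1 $ i else A $ i $ j) * inverse (det A)"
proof -
  have "invertible A" using assms by (simp add: invertible_det_nz)
  then have "A *v (matrix_inv A *v axis l 1) = axis l 1"
    by (simp add: matrix_vector_mul_assoc matrix_inv)
  then have *: "matrix_inv A *v axis l 1 = (\<chi> k. det (\<chi> i j. if j = k then axis l 1 $ i else A $ i $ j) / det A)"
    by (simp add: cramer[OF assms])
  have "matrix_inv A $ k $ l = (matrix_inv A *v axis l 1) $ k"
    by (simp add: matrix_vector_mult_basis column_def)
  also have "\<dots> = det (\<chi> i j. if j = k then axis l 1 $ i else A $ i $ j) * inverse (det A)"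
    by (subst *) (simp add: divide_inverse)
  finally show ?thesis .
qed

lemma smooth_on_matrix_inv:
  fixes M :: "'a::real_normed_vector \<Rightarrow> real^'n^'n"
  assumes "open S" "smooth_on S M" "\<And>x. x \<in> S \<Longrightarrow> det (M x) \<noteq> 0"
  shows "smooth_on S (\<lambda>x. matrix_inv (M x))"
proof (intro smooth_on_vec assms(1))
  fix k l
  have "smooth_on S (\<lambda>x. (\<chi> i j. if j = k then axis l 1 $ i else M x $ i $ j) :: real^'n^'n)"
  proof (intro smooth_on_vec assms(1))
    show "smooth_on S (\<lambda>x. (\<chi> i j. if j = k then axis l 1 $ i else M x $ i $ j) $ i $ j)" for i j
      using assms by (cases "j = k") (auto intro: smooth_on_const smooth_on_nth)
  qed
  then have "smooth_on S (\<lambda>x. det (\<chi> i j. if j = k then axis l 1 $ i else M x $ i $ j) * inverse (det (M x)))"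
    using assms by (intro smooth_on_mult smooth_on_det smooth_on_real_inverse)
  then show "smooth_on S (\<lambda>x. matrix_inv (M x) $ k $ l)"
    by (rule smooth_on_cong[OF assms(1), rotated]) (simp add: matrix_inv_cramer assms(3))
qed

section \<open>Symmetry of second derivatives\<close>

text \<open>The mean value theorem is applied twice: along \<open>u\<close> to the difference of
  \<open>g\<close> on two parallel lines, then along \<open>v\<close> to the derivative of
  \<open>g\<close> in direction \<open>u\<close>.\<close>

lemma second_difference_eq:
  fixes g :: "'a::real_normed_vector \<Rightarrow> real"
  assumes g: "smooth_on UNIV g" and h: "h > 0"
  shows "\<exists>\<xi>\<in>{0<..<h}. \<exists>\<eta>\<in>{0<..<h}.
    g (p + h *\<^sub>R u + h *\<^sub>R v) - g (p + h *\<^sub>R u) - (g (p + h *\<^sub>R v) - g p) =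
    h * (h * frechet_derivative (\<lambda>x. frechet_derivative g (at x) u) (at (p + \<xi> *\<^sub>R u + \<eta> *\<^sub>R v)) v)"
proof -
  have line: "((\<lambda>t. f (q + t *\<^sub>R w)) has_real_derivative frechet_derivative f (at (q + t *\<^sub>R w)) w) (at t)"
    if "smooth_on UNIV f" for f :: "'a \<Rightarrow> real" and q w t
  proof -
    have f: "(f has_derivative frechet_derivative f (at (q + t *\<^sub>R w))) (at (q + t *\<^sub>R w))"
      using that by (auto intro: has_derivative_frechet smooth_on_imp_differentiable)
    interpret bounded_linear "frechet_derivative f (at (q + t *\<^sub>R w))"
      using f by (rule has_derivative_bounded_linear)
    have "((\<lambda>t. f (q + t *\<^sub>R w)) has_derivative (\<lambda>s. frechet_derivative f (at (q + t *\<^sub>R w)) (s *\<^sub>R w))) (at t)"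
      by (rule has_derivative_compose[where f = "\<lambda>t. q + t *\<^sub>R w", OF _ f])
        (auto intro!: derivative_eq_intros)
    then show ?thesis by (simp add: has_field_derivative_def scaleR mult.commute[of _ "_ w"])
  qed
  let ?g = "\<lambda>x. frechet_derivative g (at x) u"
  have "((\<lambda>s. g (p + h *\<^sub>R v + s *\<^sub>R u) - g (p + s *\<^sub>R u)) has_real_derivative
      ?g (p + h *\<^sub>R v + s *\<^sub>R u) - ?g (p + s *\<^sub>R u)) (at s)" for s
    by (intro DERIV_diff line g)
  from MVT2[OF h this] obtain \<xi> where \<xi>: "0 < \<xi>" "\<xi> < h"
    "g (p + h *\<^sub>R v + h *\<^sub>R u) - g (p + h *\<^sub>R u) - (g (p + h *\<^sub>R v + 0 *\<^sub>R u) - g (p + 0 *\<^sub>R u)) =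
      (h - 0) * (?g (p + h *\<^sub>R v + \<xi> *\<^sub>R u) - ?g (p + \<xi> *\<^sub>R u))"
    by blast
  obtain \<eta> where \<eta>: "0 < \<eta>" "\<eta> < h"
    "?g (p + \<xi> *\<^sub>R u + h *\<^sub>R v) - ?g (p + \<xi> *\<^sub>R u + 0 *\<^sub>R v) =
      (h - 0) * frechet_derivative ?g (at (p + \<xi> *\<^sub>R u + \<eta> *\<^sub>R v)) v"
    using MVT2[OF h line[OF smooth_on_derivative[OF g], of "p + \<xi> *\<^sub>R u" v]] by blast
  have "h * (?g (p + h *\<^sub>R v + \<xi> *\<^sub>R u) - ?g (p + \<xi> *\<^sub>R u))
      = h * (h * frechet_derivative ?g (at (p + \<xi> *\<^sub>R u + \<eta> *\<^sub>R v)) v)"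
    using \<eta>(3) by (simp add: algebra_simps)
  then show ?thesis using \<xi> \<eta>(1,2) by (intro bexI[of _ \<xi>] bexI[of _ \<eta>]) (auto simp: algebra_simps)
qed

text \<open>The second difference is unchanged when \<open>u\<close> and \<open>v\<close> are
  swapped, so arbitrarily near \<open>p\<close> some value of one mixed derivative equals some value
  of the other; continuity does the rest.\<close>

lemma second_derivative_symmetric:
  fixes g :: "'a::real_normed_vector \<Rightarrow> real"
  assumes g: "smooth_on UNIV g"
  shows "frechet_derivative (\<lambda>x. frechet_derivative g (at x) u) (at p) v =
    frechet_derivative (\<lambda>x. frechet_derivative g (at x) v) (at p) u"
proof (rule ccontr)
  define F where "F u v x = frechet_derivative (\<lambda>x. frechet_derivative g (at x) u) (at x) v" for u v x
  assume "\<not> ?thesis"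
  \<comment> \<open>Half the gap: values strictly within this distance of the two ends cannot
    coincide.\<close>
  then have e: "\<bar>F u v p - F v u p\<bar> / 2 > 0" (is "?e > 0") by (simp add: F_def)
  have cont: "\<exists>d>0. \<forall>\<xi>\<in>{0<..<d}. \<forall>\<eta>\<in>{0<..<d}. \<bar>F u v (p + \<xi> *\<^sub>R u + \<eta> *\<^sub>R v) - F u v p\<bar> < ?e" for u v
  proof -
    have "continuous_on UNIV (F u v)"
      unfolding F_def by (intro smooth_on_imp_continuous_on smooth_on_derivative g)
    then have "continuous_on UNIV (\<lambda>z :: real \<times> real. F u v (p + fst z *\<^sub>R u + snd z *\<^sub>R v))"
      by (rule continuous_on_compose2) (auto intro!: continuous_intros)
    then obtain d where d: "d > 0"
      "\<And>z. dist z (0, 0) < d \<Longrightarrow> dist (F u v (p + fst z *\<^sub>R u + snd z *\<^sub>R v)) (F u v p) < ?e"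
      using e unfolding continuous_on_iff by (metis UNIV_I add.right_neutral fst_conv scale_zero_left snd_conv)
    have "dist (\<xi>, \<eta>) (0, 0) < d" if "\<xi> \<in> {0<..<d/2}" "\<eta> \<in> {0<..<d/2}" for \<xi> \<eta> :: real
      using that norm_Pair_le[of \<xi> \<eta>] by (auto simp: dist_norm)
    then show ?thesis using d by (intro exI[of _ "d/2"]) (force simp: dist_real_def)
  qed
  obtain d1 d2 where d: "d1 > 0" "d2 > 0"
    "\<And>\<xi> \<eta>. \<xi> \<in> {0<..<d1} \<Longrightarrow> \<eta> \<in> {0<..<d1} \<Longrightarrow> \<bar>F u v (p + \<xi> *\<^sub>R u + \<eta> *\<^sub>R v) - F u v p\<bar> < ?e"
    "\<And>\<xi> \<eta>. \<xi> \<in> {0<..<d2} \<Longrightarrow> \<eta> \<in> {0<..<d2} \<Longrightarrow> \<bar>F v u (p + \<xi> *\<^sub>R v + \<eta> *\<^sub>R u) - F v u p\<bar> < ?e"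
    using cont[of u v] cont[of v u] by blast
  define h where "h = min d1 d2"
  have h: "h > 0" using d by (simp add: h_def)
  obtain \<xi> \<eta> where 1: "\<xi> \<in> {0<..<h}" "\<eta> \<in> {0<..<h}"
    "g (p + h *\<^sub>R u + h *\<^sub>R v) - g (p + h *\<^sub>R u) - (g (p + h *\<^sub>R v) - g p) = h * (h * F u v (p + \<xi> *\<^sub>R u + \<eta> *\<^sub>R v))"
    using second_difference_eq[OF g h, of p u v] unfolding F_def by blast
  obtain \<xi>' \<eta>' where 2: "\<xi>' \<in> {0<..<h}" "\<eta>' \<in> {0<..<h}"
    "g (p + h *\<^sub>R v + h *\<^sub>R u) - g (p + h *\<^sub>R v) - (g (p + h *\<^sub>R u) - g p) = h * (h * F v u (p + \<xi>' *\<^sub>R v + \<eta>' *\<^sub>R u))"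
    using second_difference_eq[OF g h, of p v u] unfolding F_def by blast
  have "h * (h * F u v (p + \<xi> *\<^sub>R u + \<eta> *\<^sub>R v)) = h * (h * F v u (p + \<xi>' *\<^sub>R v + \<eta>' *\<^sub>R u))"
    unfolding 1(3)[symmetric] 2(3)[symmetric] by (simp add: add_ac)
  then have "F u v (p + \<xi> *\<^sub>R u + \<eta> *\<^sub>R v) = F v u (p + \<xi>' *\<^sub>R v + \<eta>' *\<^sub>R u)" using h by simp
  moreover have "\<bar>F u v (p + \<xi> *\<^sub>R u + \<eta> *\<^sub>R v) - F u v p\<bar> < ?e" using 1 by (intro d(3)) (auto simp: h_def)
  moreover have "\<bar>F v u (p + \<xi>' *\<^sub>R v + \<eta>' *\<^sub>R u) - F v u p\<bar> < ?e" using 2 by (intro d(4)) (auto simp: h_def)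
  ultimately show False by (auto simp: abs_if split: if_splits)
qed

section \<open>Manifolds embedded in a Euclidean space\<close>

text \<open>The chart \<open>\<phi>\<close> of \<open>G\<close> is the restriction of a map that is smooth on the open subset \<open>W\<close> of the
  ambient space, and \<open>c\<close> is the corresponding parametrization, defined on \<open>D\<close>. Smoothness of maps
  between such manifolds then reduces to smoothness in the ambient spaces.\<close>

definition embedded_chart ::
  "'a::euclidean_space set \<Rightarrow> 'a set \<Rightarrow> ('a \<Rightarrow> 'e::euclidean_space) \<Rightarrow> 'a set \<Rightarrow> 'e set \<Rightarrow> ('e \<Rightarrow> 'a) \<Rightarrow> bool" where
  "embedded_chart G U \<phi> W D c \<longleftrightarrow> open W \<and> U = G \<inter> W \<and> open D \<and> smooth_on W \<phi> \<and> smooth_on D c \<and>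
     (\<forall>x\<in>U. \<phi> x \<in> D \<and> c (\<phi> x) = x) \<and> (\<forall>s\<in>D. c s \<in> U \<and> \<phi> (c s) = s)"

definition embedded_manifold ::
  "('a::euclidean_space, 'e::euclidean_space) manifold \<Rightarrow> 'a set \<Rightarrow> bool" where
  "embedded_manifold M G \<longleftrightarrow> mtop M = top_of_set G \<and> G \<subseteq> (\<Union>(U, \<phi>)\<in>charts M. U) \<and>
     (\<forall>(U, \<phi>)\<in>charts M. \<exists>W D c. embedded_chart G U \<phi> W D c)"

lemma embedded_manifold_chart:
  assumes "embedded_manifold M G" "(U, \<phi>) \<in> charts M"
  obtains W D c where "embedded_chart G U \<phi> W D c"
  using assms unfolding embedded_manifold_def by blast

lemma embedded_manifold_cover:
  assumes "embedded_manifold M G" "x \<in> G"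
  obtains U \<phi> where "(U, \<phi>) \<in> charts M" "x \<in> U"
proof -
  have "x \<in> (\<Union>(U, \<phi>)\<in>charts M. U)" using assms unfolding embedded_manifold_def by blast
  then show ?thesis using that by auto
qed

lemma embedded_chartD:
  assumes "embedded_chart G U \<phi> W D c"
  shows "open W" "U = G \<inter> W" "open D" "smooth_on W \<phi>" "smooth_on D c"
    "x \<in> U \<Longrightarrow> \<phi> x \<in> D" "x \<in> U \<Longrightarrow> c (\<phi> x) = x" "s \<in> D \<Longrightarrow> c s \<in> U" "s \<in> D \<Longrightarrow> \<phi> (c s) = s"
  using assms by (auto simp: embedded_chart_def)

lemma embedded_chart_image: "embedded_chart G U \<phi> W D c \<Longrightarrow> \<phi> ` U = D"
  unfolding embedded_chart_def by force

lemma embedded_chart_inv_into: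
  assumes "embedded_chart G U \<phi> W D c" "s \<in> D" shows "inv_into U \<phi> s = c s"
proof (rule inv_into_f_eq)
  show "inj_on \<phi> U" using assms unfolding embedded_chart_def by (metis inj_onI)
qed (use assms in \<open>auto simp: embedded_chart_def\<close>)

lemma embedded_chart_homeomorphic:
  assumes "embedded_chart G U \<phi> W D c"
  shows "homeomorphic_map (top_of_set U) (top_of_set D) \<phi>"
proof (rule homeomorphic_maps_imp_map)
  have "continuous_on W \<phi>" "continuous_on D c"
    using assms by (auto simp: embedded_chart_def smooth_on_imp_continuous_on)
  then show "homeomorphic_maps (top_of_set U) (top_of_set D) \<phi> c"
    using assms unfolding homeomorphic_maps_def embedded_chart_def
    by (auto intro: continuous_on_subset)
qed

text \<open>In coordinates \<open>f\<close> is the composite of the parametrization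
  \<open>c\<close>, the ambient extension \<open>F\<close> and the chart \<psi>, all smooth between
  open sets of Euclidean spaces.\<close>

lemma embedded_chart_smooth:
  fixes F :: "'a::euclidean_space \<Rightarrow> 'b::euclidean_space"
  assumes 1: "embedded_chart G U \<phi> W D c" and 2: "embedded_chart H V \<psi> W' D' c'"
    and F: "open S" "smooth_on S F" "G \<subseteq> S"
    and f: "\<And>x. x \<in> G \<Longrightarrow> f x = F x" "f ` G \<subseteq> H"
  shows "smooth_on (\<phi> ` (U \<inter> f -` V)) (\<psi> \<circ> f \<circ> inv_into U \<phi>)"
proof -
  have c: "open D" "smooth_on D c" "c ` D \<subseteq> S" and \<psi>: "open W'" "smooth_on W' \<psi>"
    using assms unfolding embedded_chart_def by blast+
  have Fc: "smooth_on D (\<lambda>s. F (c s))"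
    using c F by (intro smooth_on_compose[OF _ F(1,2)])
  have fF: "f (c s) = F (c s)" if "s \<in> D" for s
    using 1 that f(1) by (auto simp: embedded_chart_def)
  have V: "V = H \<inter> W'" using 2 by (simp add: embedded_chart_def)
  have "f (c s) \<in> H" if "s \<in> D" for s
    using 1 that f(2) by (auto simp: embedded_chart_def)
  then have "f (c s) \<in> V \<longleftrightarrow> F (c s) \<in> W'" if "s \<in> D" for s
    using fF that by (simp add: V)
  moreover have "\<phi> ` (U \<inter> f -` V) = {s \<in> D. f (c s) \<in> V}"
  proof -
    have "\<phi> x \<in> D" "c (\<phi> x) = x" if "x \<in> U" for x using 1 that by (auto simp: embedded_chart_def)
    moreover have "c s \<in> U" "\<phi> (c s) = s" if "s \<in> D" for s using 1 that by (auto simp: embedded_chart_def)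
    ultimately show ?thesis by (force intro: rev_image_eqI)
  qed
  \<comment> \<open>\<open>V\<close> is cut out of \<open>H\<close> by the open set
    \<open>W'\<close>, and \<open>f\<close> maps into \<open>H\<close>; so the domain of the
    coordinate expression is an open preimage.\<close>
  ultimately have dom: "\<phi> ` (U \<inter> f -` V) = D \<inter> (\<lambda>s. F (c s)) -` W'" by auto
  have op: "open (D \<inter> (\<lambda>s. F (c s)) -` W')"
    using smooth_on_imp_continuous_on[OF Fc] c(1) \<psi>(1) by (rule continuous_open_preimage)
  have "smooth_on (D \<inter> (\<lambda>s. F (c s)) -` W') (\<lambda>s. \<psi> (F (c s)))"
    using smooth_on_subset[OF Fc] by (intro smooth_on_compose[OF op \<psi>]) auto
  then show ?thesis
    unfolding dom
    by (rule smooth_on_cong[OF op, rotated]) (simp add: embedded_chart_inv_into[OF 1] fF)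
qed

text \<open>The open set \<open>S\<close> around \<open>G\<close> accommodates extensions that are
  smooth only near \<open>G\<close>, such as inversion on the matrices of nonzero
  determinant.\<close>

lemma smooth_map_embedded:
  fixes F :: "'a::euclidean_space \<Rightarrow> 'b::euclidean_space"
  assumes M: "embedded_manifold M G" and N: "embedded_manifold N H"
    and F: "open S" "smooth_on S F" "G \<subseteq> S"
    and f: "\<And>x. x \<in> G \<Longrightarrow> f x = F x" "f ` G \<subseteq> H"
  shows "smooth_map M N f"
proof -
  have "continuous_on G f"
    using f(1) continuous_on_subset[OF smooth_on_imp_continuous_on[OF F(2)] F(3)]
    by (simp cong: continuous_on_cong)
  then have "continuous_map (mtop M) (mtop N) f"
    using M N f(2) by (auto simp: embedded_manifold_def)
  moreover have "smooth_on (\<phi> ` (U \<inter> f -` V)) (\<psi> \<circ> f \<circ> inv_into U \<phi>)"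
    if U: "(U, \<phi>) \<in> charts M" and V: "(V, \<psi>) \<in> charts N" for U \<phi> V \<psi>
    using embedded_manifold_chart[OF M U] embedded_manifold_chart[OF N V]
    by (metis embedded_chart_smooth[OF _ _ F f])
  ultimately show ?thesis unfolding smooth_map_def by blast
qed

text \<open>Transition maps are coordinate expressions of the identity, which extends to the ambient
  space; the Hausdorff property and second countability pass to subspaces.\<close>

lemma smooth_manifold_embedded:
  fixes M :: "('a::euclidean_space, 'e::euclidean_space) manifold"
  assumes M: "embedded_manifold M G"
  shows "smooth_manifold M"
  unfolding smooth_manifold_def
proof (intro conjI)
  have top: "mtop M = top_of_set G" using M by (simp add: embedded_manifold_def)
  show "Hausdorff_space (mtop M)" unfolding top by (simp add: Hausdorff_space_subtopology)
  have "second_countable (euclidean :: 'a topology)"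
  proof -
    obtain B :: "'a set set" where "countable B" "topological_basis B"
      using ex_countable_basis by blast
    then show ?thesis
      unfolding second_countable_def by (metis open_openin topological_basis_def topological_basis_iff)
  qed
  then show "second_countable (mtop M)" unfolding top by (rule second_countable_subtopology)
  have sub: "U \<subseteq> G" if "(U, \<phi>) \<in> charts M" for U \<phi>
    using embedded_manifold_chart[OF M that] embedded_chartD(2) by (metis inf_le1)
  then have "(\<Union>(U, \<phi>)\<in>charts M. U) = G"
    by (auto elim!: embedded_manifold_cover[OF M])
  then show "(\<Union>(U, \<phi>)\<in>charts M. U) = topspace (mtop M)" by (simp add: top)
  show "\<forall>(U, \<phi>)\<in>charts M. openin (mtop M) U \<and> open (\<phi> ` U) \<and>
        homeomorphic_map (subtopology (mtop M) U) (top_of_set (\<phi> ` U)) \<phi>"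
  proof (clarify)
    fix U \<phi> assume U: "(U, \<phi>) \<in> charts M"
    then obtain W D c where c: "embedded_chart G U \<phi> W D c" by (rule embedded_manifold_chart[OF M])
    note embedded_chartD(1-3)[OF this]
    then show "openin (mtop M) U \<and> open (\<phi> ` U) \<and>
        homeomorphic_map (subtopology (mtop M) U) (top_of_set (\<phi> ` U)) \<phi>"
      using embedded_chart_homeomorphic[OF c] sub[OF U]
      unfolding embedded_chart_image[OF c] top subtopology_subtopology by (auto simp: inf_absorb2)
  qed
  show "\<forall>(U, \<phi>)\<in>charts M. \<forall>(V, \<psi>)\<in>charts M. smooth_on (\<phi> ` (U \<inter> V)) (\<psi> \<circ> inv_into U \<phi>)"
  proof (clarify)
    fix U \<phi> V \<psi> assume U: "(U, \<phi>) \<in> charts M" and V: "(V, \<psi>) \<in> charts M"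
    obtain W D c W' D' c' where c: "embedded_chart G U \<phi> W D c" "embedded_chart G V \<psi> W' D' c'"
      using embedded_manifold_chart[OF M U] embedded_manifold_chart[OF M V] by metis
    show "smooth_on (\<phi> ` (U \<inter> V)) (\<psi> \<circ> inv_into U \<phi>)"
      using embedded_chart_smooth[OF c open_UNIV smooth_on_linear[OF bounded_linear_ident], of "\<lambda>x. x"]
      by (simp add: vimage_def comp_def)
  qed
qed

lemma embedded_manifold_euclidean:
  "embedded_manifold (euclidean_manifold :: ('e::euclidean_space, 'e) manifold) UNIV"
proof -
  have "embedded_chart UNIV UNIV (\<lambda>x :: 'e. x) UNIV UNIV (\<lambda>x. x)"
    by (simp add: embedded_chart_def smooth_on_linear)
  then show ?thesis by (auto simp: embedded_manifold_def euclidean_manifold_def)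
qed

lemma embedded_chart_Times:
  assumes "embedded_chart G U \<phi> W D c" "embedded_chart H V \<psi> W' D' c'"
  shows "embedded_chart (G \<times> H) (U \<times> V) (map_prod \<phi> \<psi>) (W \<times> W') (D \<times> D') (map_prod c c')"
proof -
  have *: "smooth_on (A \<times> B) (map_prod f g)"
    if "open A" "open B" "smooth_on A f" "smooth_on B g"
    for A :: "'x::euclidean_space set" and B :: "'y::euclidean_space set"
      and f :: "'x \<Rightarrow> 'u::euclidean_space" and g :: "'y \<Rightarrow> 'v::euclidean_space"
    unfolding map_prod_def case_prod_unfold using that
    by (intro smooth_on_Pair smooth_on_compose[OF _ that(1,3)] smooth_on_compose[OF _ that(2,4)]
        smooth_on_linear open_Times bounded_linear_fst bounded_linear_snd) auto
  note \<phi> = embedded_chartD[OF assms(1)] and \<psi> = embedded_chartD[OF assms(2)]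
  have "smooth_on (W \<times> W') (map_prod \<phi> \<psi>)" "smooth_on (D \<times> D') (map_prod c c')"
    by (intro * \<phi> \<psi>)+
  moreover have "U \<times> V = (G \<times> H) \<inter> (W \<times> W')" by (subst \<phi>(2), subst \<psi>(2)) blast
  moreover have "map_prod \<phi> \<psi> x \<in> D \<times> D'" "map_prod c c' (map_prod \<phi> \<psi> x) = x" if "x \<in> U \<times> V" for x
    using that \<phi>(6,7) \<psi>(6,7) by (cases x; simp)+
  moreover have "map_prod c c' s \<in> U \<times> V" "map_prod \<phi> \<psi> (map_prod c c' s) = s" if "s \<in> D \<times> D'" for s
    using that \<phi>(8,9) \<psi>(8,9) by (cases s; simp)+
  ultimately show ?thesis
    unfolding embedded_chart_def using \<phi>(1,3) \<psi>(1,3) by (blast intro: open_Times)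
qed

lemma embedded_manifold_prod:
  assumes M: "embedded_manifold M G" and N: "embedded_manifold N H"
  shows "embedded_manifold (prod_manifold M N) (G \<times> H)"
  unfolding embedded_manifold_def
proof (intro conjI)
  show "mtop (prod_manifold M N) = top_of_set (G \<times> H)"
    using M N by (simp add: embedded_manifold_def prod_manifold_def subtopology_Times)
  show "G \<times> H \<subseteq> (\<Union>(U, \<phi>)\<in>charts (prod_manifold M N). U)"
  proof
    fix x assume "x \<in> G \<times> H"
    then obtain y z where x: "x = (y, z)" "y \<in> G" "z \<in> H" by auto
    obtain U \<phi> where U: "(U, \<phi>) \<in> charts M" "y \<in> U" by (rule embedded_manifold_cover[OF M x(2)])
    obtain V \<psi> where V: "(V, \<psi>) \<in> charts N" "z \<in> V" by (rule embedded_manifold_cover[OF N x(3)])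
    have "(U \<times> V, map_prod \<phi> \<psi>) \<in> charts (prod_manifold M N)"
      using U V by (auto simp: prod_manifold_def)
    then show "x \<in> (\<Union>(U, \<phi>)\<in>charts (prod_manifold M N). U)" using U V x(1) by blast
  qed
  show "\<forall>(U, \<phi>)\<in>charts (prod_manifold M N). \<exists>W D c. embedded_chart (G \<times> H) U \<phi> W D c"
  proof (clarify)
    fix U \<phi> assume "(U, \<phi>) \<in> charts (prod_manifold M N)"
    then obtain U1 \<phi>1 U2 \<phi>2 where U: "(U1, \<phi>1) \<in> charts M" "(U2, \<phi>2) \<in> charts N"
      and eq: "U = U1 \<times> U2" "\<phi> = map_prod \<phi>1 \<phi>2"
      by (auto simp: prod_manifold_def)
    then show "\<exists>W D c. embedded_chart (G \<times> H) U \<phi> W D c"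
      using embedded_manifold_chart[OF M U(1)] embedded_manifold_chart[OF N U(2)]
        embedded_chart_Times unfolding eq by metis
  qed
qed

section \<open>Matrices\<close>

lemmas matrix_mult_linear_simps =
  bounded_bilinear.add_left[OF bounded_bilinear_matrix_matrix_mult]
  bounded_bilinear.add_right[OF bounded_bilinear_matrix_matrix_mult]
  bounded_bilinear.diff_left[OF bounded_bilinear_matrix_matrix_mult]
  bounded_bilinear.diff_right[OF bounded_bilinear_matrix_matrix_mult]
  bounded_bilinear.minus_left[OF bounded_bilinear_matrix_matrix_mult]
  bounded_bilinear.minus_right[OF bounded_bilinear_matrix_matrix_mult]
  bounded_bilinear.scaleR_left[OF bounded_bilinear_matrix_matrix_mult]
  bounded_bilinear.scaleR_right[OF bounded_bilinear_matrix_matrix_mult]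
  bounded_bilinear.zero_left[OF bounded_bilinear_matrix_matrix_mult]
  bounded_bilinear.zero_right[OF bounded_bilinear_matrix_matrix_mult]

lemma linear_transpose: "linear (transpose :: real^'n^'m \<Rightarrow> real^'m^'n)"
  by (auto simp: linear_iff transpose_def vec_eq_iff)

lemmas transpose_linear_simps =
  linear_add[OF linear_transpose] linear_diff[OF linear_transpose]
  linear_neg[OF linear_transpose] linear_scale[OF linear_transpose]

lemma matrix_inv_unique:
  fixes M :: "real^'n^'n"
  assumes "M ** N = mat 1" shows "matrix_inv M = N"
proof -
  have "invertible M" using assms invertible_right_inverse by blast
  then have "matrix_inv M ** M = mat 1" by (rule matrix_inv)
  then show ?thesis by (metis assms matrix_mul_assoc matrix_mul_lid matrix_mul_rid)
qed

lemma det_nz_matrix_inv: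
  fixes M :: "real^'n^'n"
  assumes "det M \<noteq> 0" shows "M ** matrix_inv M = mat 1" "matrix_inv M ** M = mat 1"
  using assms by (auto simp: invertible_det_nz[symmetric] matrix_inv)

lemma det_nzI: "(M :: real^'n^'n) ** N = mat 1 \<Longrightarrow> det M \<noteq> 0"
  by (metis det_I det_mul mult_zero_left zero_neq_one)

text \<open>With the vectors as columns of a square matrix, independence is left invertibility,
  hence right invertibility, hence spanning. A spanning set of at most the dimension many vectors is
  independent.\<close>

lemma basis_of_linear_independent:
  fixes v :: "'n \<Rightarrow> real^'n"
  assumes "\<And>x. (\<Sum>i\<in>UNIV. x i *\<^sub>R v i) = 0 \<Longrightarrow> (\<forall>i. x i = 0)"
  shows "inj v" "independent (range v)" "span (range v) = UNIV"
proof -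
  define M :: "real^'n^'n" where "M = transpose (\<chi> i. v i)"
  have col: "column i M = v i" for i by (simp add: M_def column_def transpose_def vec_eq_iff)
  have "\<exists>B. B ** M = mat 1"
    unfolding matrix_left_invertible_independent_columns col using assms
    by (simp add: scalar_mult_eq_scaleR)
  then have "\<exists>B. M ** B = mat 1" using matrix_left_right_inverse by blast
  then have "vec.span (columns M) = UNIV" by (simp add: matrix_right_invertible_span_columns)
  then show span: "span (range v) = UNIV"
    by (simp add: columns_def col span_vec_eq full_SetCompr_eq)
  have "card (range v) \<le> dim (UNIV :: (real^'n) set)" using card_image_le[of UNIV v] by simp
  then show "independent (range v)"
    by (intro card_le_dim_spanning[of _ UNIV]) (auto simp: span)
  show "inj v"
  proof (rule injI, rule ccontr)
    fix i j assume "v i = v j" "i \<noteq> j"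
    \<comment> \<open>Equal vectors at two indices give the nontrivial relation with coefficients 1
      and -1.\<close>
    then have "(\<Sum>k\<in>UNIV. (of_bool (k = i) - of_bool (k = j) :: real) *\<^sub>R v k) = 0"
      by (simp add: scaleR_left_diff_distrib sum_subtractf of_bool_def if_distrib[of "\<lambda>c. c *\<^sub>R _"] cong: if_cong)
    from assms[OF this] have "of_bool (i = i) - of_bool (i = j) = (0::real)" by blast
    with \<open>i \<noteq> j\<close> show False by simp
  qed
qed

section \<open>The isometry group of a symmetric bilinear form\<close>

definition isometries :: "real^'n^'n \<Rightarrow> (real^'n^'n) set" where
  "isometries A = {g. transpose g ** A ** g = A}"

definition isometry_group :: "real^'n^'n \<Rightarrow> (real^'n^'n) monoid" where
  "isometry_group A = \<lparr>carrier = isometries A, mult = (**), one = mat 1\<rparr>"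

lemma isometries_det: "det A \<noteq> 0 \<Longrightarrow> g \<in> isometries A \<Longrightarrow> det g \<noteq> 0"
  unfolding isometries_def by (metis (mono_tags) det_mul mem_Collect_eq mult_zero_right)

lemma isometries_one: "mat 1 \<in> isometries A"
  by (simp add: isometries_def)

lemma isometries_mult:
  assumes "g \<in> isometries A" "h \<in> isometries A" shows "g ** h \<in> isometries A"
proof -
  have "transpose (g ** h) ** A ** (g ** h) = transpose h ** (transpose g ** A ** g) ** h"
    by (simp add: matrix_transpose_mul matrix_mul_assoc)
  with assms show ?thesis by (simp add: isometries_def)
qed

lemma isometries_inv:
  assumes "det A \<noteq> 0" "g \<in> isometries A" shows "matrix_inv g \<in> isometries A"
proof -
  note inv = det_nz_matrix_inv[OF isometries_det[OF assms]]
  have "transpose (matrix_inv g) ** (transpose g ** A ** g) ** matrix_inv g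
      = transpose (g ** matrix_inv g) ** A ** (g ** matrix_inv g)"
    by (simp add: matrix_transpose_mul matrix_mul_assoc)
  with assms show ?thesis by (simp add: isometries_def inv)
qed

lemma group_isometry_group:
  assumes "det A \<noteq> 0" shows "group (isometry_group A)"
proof (rule groupI)
  show "\<exists>y\<in>carrier (isometry_group A). y \<otimes>\<^bsub>isometry_group A\<^esub> x = \<one>\<^bsub>isometry_group A\<^esub>"
    if "x \<in> carrier (isometry_group A)" for x
    using that isometries_inv[OF assms] det_nz_matrix_inv[OF isometries_det[OF assms]]
    by (auto simp: isometry_group_def)
qed (auto simp: isometry_group_def isometries_one isometries_mult matrix_mul_assoc)

lemma inv_isometry_group:
  assumes "det A \<noteq> 0" "g \<in> isometries A" shows "inv\<^bsub>isometry_group A\<^esub> g = matrix_inv g"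
  using group.inv_equality[OF group_isometry_group[OF assms(1)], of "matrix_inv g" g]
    isometries_inv[OF assms] det_nz_matrix_inv[OF isometries_det[OF assms]] assms(2)
  by (simp add: isometry_group_def)

text \<open>The Cayley transform \<open>X = (k - 1)(k + 1)\<^sup>-\<^sup>1 = 1 - 2(k + 1)\<^sup>-\<^sup>1\<close> and its inverse
  \<open>k = 2(1 - X)\<^sup>-\<^sup>1 - 1\<close> exchange isometries and infinitesimal isometries.\<close>

lemma cayley_infinitesimal_isometry:
  fixes A k M :: "real^'n^'n"
  assumes k: "k \<in> isometries A" and M: "(k + mat 1) ** M = mat 1"
  defines "X \<equiv> mat 1 - 2 *\<^sub>R M"
  shows "A ** X + transpose X ** A = 0"
proof -
  let ?N = "k + mat 1"
  have MT: "transpose M ** transpose ?N = mat 1"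
    using M by (metis matrix_transpose_mul transpose_mat)
  \<comment> \<open>With \<open>N = k + 1\<close> the isometry equation replaces
    \<open>transpose k ** A ** k\<close> by \<open>A\<close>, and the product becomes linear in
    \<open>N\<close>.\<close>
  have "transpose ?N ** A ** ?N = transpose k ** A ** k + transpose k ** A + A ** k + A"
    by (simp add: transpose_linear_simps matrix_mult_linear_simps algebra_simps)
  also have "\<dots> = A ** ?N + transpose ?N ** A"
    using k by (simp add: isometries_def transpose_linear_simps matrix_mult_linear_simps algebra_simps)
  \<comment> \<open>Multiplying by \<open>transpose M\<close> and \<open>M\<close> cancels
    \<open>N\<close> and leaves a linear equation for \<open>M\<close>, which is the claim about
    \<open>1 - 2M\<close>.\<close>
  finally have "transpose M ** (transpose ?N ** A ** ?N) ** M =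
      transpose M ** (A ** ?N + transpose ?N ** A) ** M" by simp
  then have "(transpose M ** transpose ?N) ** A ** (?N ** M) =
      transpose M ** A ** (?N ** M) + (transpose M ** transpose ?N) ** A ** M"
    by (simp only: matrix_mult_linear_simps matrix_mul_assoc)
  then have *: "transpose M ** A + A ** M = A" by (simp add: M MT add.commute)
  have "A ** X + transpose X ** A = 2 *\<^sub>R A - 2 *\<^sub>R (transpose M ** A + A ** M)"
    unfolding X_def transpose_linear_simps matrix_mult_linear_simps
    by (simp add: scaleR_2 algebra_simps scaleR_right_distrib)
  then show ?thesis by (simp only: * cancel_comm_monoid_add_class.diff_cancel)
qed

text \<open>For \<open>Y = 1 - X\<close> the hypothesis reads
  \<open>A ** Y + transpose Y ** A = 2A\<close>. Conjugation by \<open>M\<close> turns this into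
  \<open>transpose M ** A + A ** M = 2 (transpose M ** A ** M)\<close>, so in the expansion for
  \<open>2M - 1\<close> everything but \<open>A\<close> cancels.\<close>

lemma cayley_isometry:
  fixes A X M :: "real^'n^'n"
  assumes X: "A ** X + transpose X ** A = 0" and M: "(mat 1 - X) ** M = mat 1"
  shows "2 *\<^sub>R M - mat 1 \<in> isometries A"
proof -
  let ?Y = "mat 1 - X"
  have MT: "transpose M ** transpose ?Y = mat 1"
    using M by (metis matrix_transpose_mul transpose_mat)
  have "A ** ?Y + transpose ?Y ** A = 2 *\<^sub>R A - (A ** X + transpose X ** A)"
    by (simp add: transpose_linear_simps matrix_mult_linear_simps scaleR_2)
  then have "transpose M ** (A ** ?Y + transpose ?Y ** A) ** M = transpose M ** (2 *\<^sub>R A) ** M"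
    using X by simp
  then have "transpose M ** A ** (?Y ** M) + (transpose M ** transpose ?Y) ** A ** M
      = 2 *\<^sub>R (transpose M ** A ** M)"
    by (simp only: matrix_mult_linear_simps matrix_mul_assoc)
  then have *: "transpose M ** A + A ** M = 2 *\<^sub>R (transpose M ** A ** M)" by (simp add: M MT)
  have "transpose (2 *\<^sub>R M - mat 1) ** A ** (2 *\<^sub>R M - mat 1)
      = 2 *\<^sub>R (2 *\<^sub>R (transpose M ** A ** M)) - 2 *\<^sub>R (transpose M ** A + A ** M) + A"
    by (simp add: transpose_linear_simps matrix_mult_linear_simps algebra_simps)
  then show ?thesis by (simp add: * isometries_def)
qed

section \<open>Skew-symmetric matrices and the Lie group structure\<close>

text \<open>\<open>skew s *v x\<close> is the cross product of \<open>x\<close> with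
  \<open>s\<close>, in this order; the sign makes X_i the value of \<open>skew (axis i 1)\<close> on
  the gradient of f.\<close>

definition skew :: "real^3 \<Rightarrow> real^3^3" where
  "skew s = vector [vector [0, s$3, - s$2], vector [- s$3, 0, s$1], vector [s$2, - s$1, 0]]"

definition unskew :: "real^3^3 \<Rightarrow> real^3" where
  "unskew K = vector [K$2$3, K$3$1, K$1$2]"

lemma bounded_linear_skew: "bounded_linear skew"
  by (rule linear_conv_bounded_linear[THEN iffD1]) (auto simp: linear_iff skew_def vec_eq_iff forall_3)

lemma bounded_linear_unskew: "bounded_linear unskew"
  by (rule linear_conv_bounded_linear[THEN iffD1]) (auto simp: linear_iff unskew_def vec_eq_iff forall_3)

lemma transpose_skew: "transpose (skew s) = - skew s"
  by (simp add: skew_def transpose_def vec_eq_iff forall_3)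

lemma unskew_skew: "unskew (skew s) = s"
  by (simp add: skew_def unskew_def vec_eq_iff forall_3)

lemma skew_unskew:
  assumes "transpose K = - K" shows "skew (unskew K) = K"
proof -
  have K: "K $ j $ i = - K $ i $ j" for i j
    using arg_cong[OF assms, of "\<lambda>M. M $ i $ j"] by (simp add: transpose_def)
  have "K $ i $ i = 0" for i using K[of i i] by simp
  then show ?thesis
    using K[of 1 2] K[of 1 3] K[of 2 3] by (simp add: skew_def unskew_def vec_eq_iff forall_3)
qed

text \<open>Both terms are \<open>A ** skew s ** A\<close> up to opposite signs, by symmetry of
  \<open>A\<close> and skewness of \<open>skew s\<close>.\<close>

lemma skew_infinitesimal_isometry:
  assumes "transpose A = A"
  shows "A ** (skew s ** A) + transpose (skew s ** A) ** A = 0"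
  using assms by (simp add: matrix_transpose_mul transpose_skew matrix_mult_linear_simps matrix_mul_assoc)

text \<open>\<open>X ** matrix_inv A\<close> is skew, because the inverse of \<open>A\<close> is
  symmetric too; so every infinitesimal isometry has the form \<open>skew s ** A\<close>.\<close>

lemma infinitesimal_isometry_skew:
  assumes A: "transpose A = A" "det A \<noteq> 0" and X: "A ** X + transpose X ** A = 0"
  shows "skew (unskew (X ** matrix_inv A)) ** A = X"
proof -
  let ?B = "matrix_inv A"
  note inv = det_nz_matrix_inv[OF A(2)]
  have "transpose ?B ** A = mat 1" using inv(1) A(1) by (metis matrix_transpose_mul transpose_mat)
  then have "A ** transpose ?B = mat 1" by (simp only: matrix_left_right_inverse)
  then have BT: "transpose ?B = ?B" by (rule matrix_inv_unique[symmetric])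
  have "transpose (X ** ?B) = ?B ** (transpose X ** A) ** ?B"
    by (simp add: matrix_transpose_mul BT matrix_mul_assoc[symmetric] inv)
  also have "transpose X ** A = - (A ** X)" using X by (simp add: eq_neg_iff_add_eq_0 add.commute)
  also have "?B ** - (A ** X) ** ?B = - ((?B ** A) ** X ** ?B)"
    by (simp add: matrix_mult_linear_simps matrix_mul_assoc)
  finally have "transpose (X ** ?B) = - (X ** ?B)" by (simp add: inv)
  then show ?thesis by (simp add: skew_unskew matrix_mul_assoc[symmetric] inv)
qed

text \<open>The Cayley transform of \<open>matrix_inv h ** g\<close> is an infinitesimal isometry;
  dividing it by \<open>A\<close> makes it skew, and its three entries are the coordinates. The
  chart is centred at \<open>h\<close>.\<close>

definition cayley_chart :: "real^3^3 \<Rightarrow> real^3^3 \<Rightarrow> real^3^3 \<Rightarrow> real^3" where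
  "cayley_chart A h g = unskew ((mat 1 - 2 *\<^sub>R matrix_inv (matrix_inv h ** g + mat 1)) ** matrix_inv A)"

definition cayley_param :: "real^3^3 \<Rightarrow> real^3^3 \<Rightarrow> real^3 \<Rightarrow> real^3^3" where
  "cayley_param A h s = h ** (2 *\<^sub>R matrix_inv (mat 1 - skew s ** A) - mat 1)"

text \<open>Excludes the \<open>g\<close> for which \<open>matrix_inv h ** g\<close> has eigenvalue
  -1. It is taken among all matrices, so that it can be the ambient open set of an embedded
  chart.\<close>

definition cayley_domain :: "real^3^3 \<Rightarrow> (real^3^3) set" where
  "cayley_domain h = {g. det (matrix_inv h ** g + mat 1) \<noteq> 0}"

definition isometry_manifold :: "real^3^3 \<Rightarrow> (real^3^3, real^3) manifold" where
  "isometry_manifold A = \<lparr>mtop = top_of_set (isometries A),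
     charts = (\<lambda>h. (isometries A \<inter> cayley_domain h, cayley_chart A h)) ` isometries A\<rparr>"

lemma embedded_chart_cayley:
  assumes A: "transpose A = A" "det A \<noteq> 0" and h: "h \<in> isometries A"
  shows "embedded_chart (isometries A) (isometries A \<inter> cayley_domain h) (cayley_chart A h)
    (cayley_domain h) {s. det (mat 1 - skew s ** A) \<noteq> 0} (cayley_param A h)"
proof -
  note hinv = det_nz_matrix_inv[OF isometries_det[OF A(2) h]]
  note Ainv = det_nz_matrix_inv[OF A(2)]
  let ?D = "{s. det (mat 1 - skew s ** A) \<noteq> 0}"
  have sm: "smooth_on S (\<lambda>g. matrix_inv h ** g + mat 1)" if "open S" for S
    using that by (intro smooth_on_add smooth_on_matrix_mult smooth_on_const smooth_on_linear bounded_linear_ident)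
  have sD: "smooth_on S (\<lambda>s. mat 1 - skew s ** A)" if "open S" for S
    using that by (intro smooth_on_diff smooth_on_matrix_mult smooth_on_const smooth_on_linear bounded_linear_skew)
  have "open ((\<lambda>g. det (matrix_inv h ** g + mat 1)) -` (- {0}))"
    using smooth_on_imp_continuous_on[OF smooth_on_det[OF open_UNIV sm[OF open_UNIV]]]
    by (intro open_vimage) (auto simp: open_Compl)
  then have W: "open (cayley_domain h)" by (simp add: cayley_domain_def vimage_def)
  have "open ((\<lambda>s. det (mat 1 - skew s ** A)) -` (- {0}))"
    using smooth_on_imp_continuous_on[OF smooth_on_det[OF open_UNIV sD[OF open_UNIV]]]
    by (intro open_vimage) (auto simp: open_Compl)
  then have D: "open ?D" by (simp add: vimage_def)
  have smooth1: "smooth_on (cayley_domain h) (cayley_chart A h)"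
    unfolding cayley_chart_def
    using smooth_on_matrix_inv[OF W sm[OF W]]
    by (intro smooth_on_linear_compose[OF W bounded_linear_unskew] smooth_on_matrix_mult smooth_on_diff
        smooth_on_const smooth_on_linear_compose[OF W bounded_linear_scaleR_right] W)
      (auto simp: cayley_domain_def)
  have smooth2: "smooth_on ?D (cayley_param A h)"
    unfolding cayley_param_def
    using smooth_on_matrix_inv[OF D sD[OF D]]
    by (intro smooth_on_matrix_mult smooth_on_diff
        smooth_on_const smooth_on_linear_compose[OF D bounded_linear_scaleR_right] D) auto
  have 1: "cayley_chart A h g \<in> ?D" "cayley_param A h (cayley_chart A h g) = g"
    if g: "g \<in> isometries A \<inter> cayley_domain h" for g
  proof -
    define k where "k = matrix_inv h ** g"
    define M where "M = matrix_inv (k + mat 1)"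
    have k: "k \<in> isometries A" using g h A(2) by (auto simp: k_def isometries_mult isometries_inv)
    have M: "(k + mat 1) ** M = mat 1"
      using g unfolding M_def k_def by (intro det_nz_matrix_inv) (auto simp: cayley_domain_def)
    have X: "skew (cayley_chart A h g) ** A = mat 1 - 2 *\<^sub>R M"
      using infinitesimal_isometry_skew[OF A cayley_infinitesimal_isometry[OF k M]]
      by (simp add: cayley_chart_def M_def k_def)
    \<comment> \<open>Here \<open>1 - X = 2M\<close> and \<open>M\<close> inverts
      \<open>k + 1\<close>. Hence the coordinates lie in the parameter domain, and the inverse
      transform returns \<open>k\<close>.\<close>
    have Y: "(mat 1 - skew (cayley_chart A h g) ** A) ** ((1/2) *\<^sub>R (k + mat 1)) = mat 1"
      using M by (simp add: X matrix_mult_linear_simps(7,8) matrix_left_right_inverse)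
    then show "cayley_chart A h g \<in> ?D" using det_nzI by blast
    show "cayley_param A h (cayley_chart A h g) = g"
      by (simp add: cayley_param_def matrix_inv_unique[OF Y] k_def matrix_mul_assoc hinv)
  qed
  have 2: "cayley_param A h s \<in> isometries A \<inter> cayley_domain h" "cayley_chart A h (cayley_param A h s) = s"
    if s: "s \<in> ?D" for s
  proof -
    define Y where "Y = mat 1 - skew s ** A"
    define M where "M = matrix_inv Y"
    have M: "Y ** M = mat 1" using s unfolding M_def Y_def by (intro det_nz_matrix_inv) auto
    have k: "2 *\<^sub>R M - mat 1 \<in> isometries A"
      using cayley_isometry[OF skew_infinitesimal_isometry[OF A(1)]] M unfolding Y_def by blast
    have hk: "matrix_inv h ** cayley_param A h s + mat 1 = 2 *\<^sub>R M"
      by (simp add: cayley_param_def matrix_mul_assoc hinv M_def Y_def)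
    \<comment> \<open>Half of \<open>Y\<close> inverts \<open>2M\<close>, so the Cayley transform is
      defined here and returns \<open>1 - Y = skew s ** A\<close>.\<close>
    have N: "(2 *\<^sub>R M) ** ((1/2) *\<^sub>R Y) = mat 1"
      using M by (simp add: matrix_mult_linear_simps(7,8) matrix_left_right_inverse)
    show "cayley_param A h s \<in> isometries A \<inter> cayley_domain h"
      using isometries_mult[OF h k] det_nzI[OF N] hk
      by (simp add: cayley_domain_def) (simp add: cayley_param_def M_def Y_def)
    show "cayley_chart A h (cayley_param A h s) = s"
      unfolding cayley_chart_def hk matrix_inv_unique[OF N]
      by (simp add: Y_def matrix_mul_assoc[symmetric] Ainv unskew_skew)
  qed
  show ?thesis
    unfolding embedded_chart_def using W D smooth1 smooth2 1 2 by blast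
qed

lemma embedded_isometry_manifold:
  assumes A: "transpose A = A" "det A \<noteq> 0"
  shows "embedded_manifold (isometry_manifold A) (isometries A)"
proof -
  have "g \<in> cayley_domain g" if "g \<in> isometries A" for g
  proof -
    \<comment> \<open>Every \<open>g\<close> lies in the chart centred at itself, where the matrix
      to be inverted is twice the identity.\<close>
    have "(mat 1 + mat 1) ** ((1/2) *\<^sub>R mat 1) = (mat 1 :: real^3^3)"
      by (simp add: matrix_mult_linear_simps scaleR_2[symmetric])
    from det_nzI[OF this] show ?thesis
      using det_nz_matrix_inv[OF isometries_det[OF A(2) that]] by (simp add: cayley_domain_def)
  qed
  moreover have "\<exists>W D c. embedded_chart (isometries A) (isometries A \<inter> cayley_domain h) (cayley_chart A h) W D c"
    if "h \<in> isometries A" for h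
    using embedded_chart_cayley[OF A that] by blast
  ultimately show ?thesis unfolding embedded_manifold_def isometry_manifold_def by auto
qed

lemma lie_group_isometry_group:
  assumes A: "transpose A = A" "det A \<noteq> 0"
  shows "lie_group (isometry_group A) (isometry_manifold A)"
  unfolding lie_group_def
proof (intro conjI)
  note M = embedded_isometry_manifold[OF A]
  show "group (isometry_group A)" by (rule group_isometry_group[OF A(2)])
  show "smooth_manifold (isometry_manifold A)" by (rule smooth_manifold_embedded[OF M])
  show "topspace (mtop (isometry_manifold A)) = carrier (isometry_group A)"
    by (simp add: isometry_manifold_def isometry_group_def)
  show "smooth_map (prod_manifold (isometry_manifold A) (isometry_manifold A)) (isometry_manifold A)
      (\<lambda>(g, h). g \<otimes>\<^bsub>isometry_group A\<^esub> h)"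
  proof (rule smooth_map_embedded[OF embedded_manifold_prod[OF M M] M open_UNIV])
    show "smooth_on UNIV (\<lambda>x. fst x ** snd x :: real^3^3)"
      by (intro smooth_on_matrix_mult smooth_on_linear bounded_linear_fst bounded_linear_snd open_UNIV)
  qed (auto simp: isometry_group_def isometries_mult)
  show "smooth_map (isometry_manifold A) (isometry_manifold A) (\<lambda>g. inv\<^bsub>isometry_group A\<^esub> g)"
  proof (rule smooth_map_embedded[OF M M])
    show op: "open {g :: real^3^3. det g \<noteq> 0}"
    proof -
      have "continuous_on UNIV (det :: real^3^3 \<Rightarrow> real)"
        by (intro smooth_on_imp_continuous_on smooth_on_det smooth_on_linear bounded_linear_ident open_UNIV)
      then have "open (det -` (- {0 :: real}) :: (real^3^3) set)"
        by (intro open_vimage) (auto simp: open_Compl)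
      then show ?thesis by (simp add: vimage_def)
    qed
    show "smooth_on {g :: real^3^3. det g \<noteq> 0} matrix_inv"
      by (intro smooth_on_matrix_inv op smooth_on_linear bounded_linear_ident) auto
  qed (use A in \<open>auto simp: isometries_det inv_isometry_group isometries_inv\<close>)
qed

lemma smooth_action_isometry_group:
  assumes A: "transpose A = A" "det A \<noteq> 0"
  shows "smooth_action (isometry_group A) (isometry_manifold A) (*v)"
  unfolding smooth_action_def
proof
  note M = embedded_isometry_manifold[OF A]
  have Bij: "(*v) g \<in> Bij UNIV" if "g \<in> isometries A" for g
  proof -
    have "bij ((*v) g)"
      using det_nz_matrix_inv[OF isometries_det[OF A(2) that]]
      by (intro o_bij[of "(*v) (matrix_inv g)"]) (auto simp: fun_eq_iff matrix_vector_mul_assoc)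
    then show ?thesis by (simp add: Bij_def)
  qed
  have "(*v) \<in> hom (isometry_group A) (BijGroup UNIV)"
    by (auto simp: hom_def isometry_group_def BijGroup_def Bij compose_def fun_eq_iff
        matrix_vector_mul_assoc)
  then show "group_action (isometry_group A) UNIV (*v)"
    using group_isometry_group[OF A(2)] group_BijGroup
    by (simp add: group_action_def group_hom_def group_hom_axioms_def)
  show "smooth_map (prod_manifold (isometry_manifold A) euclidean_manifold) euclidean_manifold
      (\<lambda>(g, p). g *v p)"
  proof (rule smooth_map_embedded[OF embedded_manifold_prod[OF M embedded_manifold_euclidean]
        embedded_manifold_euclidean open_UNIV])
    show "smooth_on UNIV (\<lambda>x :: (real^3^3) \<times> (real^3). fst x *v snd x)"
      by (intro smooth_on_matrix_vector_mult smooth_on_linear bounded_linear_fst bounded_linear_snd open_UNIV)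
  qed auto
qed

section \<open>One-parameter subgroups\<close>

text \<open>The functions are \<open>sin (\<omega>t) / \<omega>\<close> and \<open>(1 - cos (\<omega>t)) / \<omega>\<^sup>2\<close> with \<open>\<omega>\<^sup>2 = \<kappa>\<close>, or their
  hyperbolic and parabolic versions.\<close>

lemma generalized_sine_exists:
  fixes \<kappa> :: real
  obtains a b :: "real \<Rightarrow> real" where "a 0 = 0" "b 0 = 0"
    "\<And>t. (a has_real_derivative 1 - \<kappa> * b t) (at t)" "\<And>t. (b has_real_derivative a t) (at t)"
proof -
  consider "\<kappa> = 0" | "\<kappa> > 0" | "\<kappa> < 0" by linarith
  then show ?thesis
  proof cases
    case 1
    show ?thesis
      by (rule that[of "\<lambda>t. t" "\<lambda>t. t\<^sup>2 / 2"]) (auto simp: 1 intro!: derivative_eq_intros)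
  next
    case 2
    define w where "w = sqrt \<kappa>"
    have w: "w \<noteq> 0" "\<kappa> = w * w" using 2 by (auto simp: w_def)
    show ?thesis
      by (rule that[of "\<lambda>t. sin (w * t) / w" "\<lambda>t. (1 - cos (w * t)) / \<kappa>"])
        (use w in \<open>auto intro!: derivative_eq_intros simp: field_simps\<close>)
  next
    case 3
    define w where "w = sqrt (- \<kappa>)"
    have w: "w \<noteq> 0" "\<kappa> = - (w * w)" using 3 by (auto simp: w_def)
    show ?thesis
      by (rule that[of "\<lambda>t. sinh (w * t) / w" "\<lambda>t. (1 - cosh (w * t)) / \<kappa>"])
        (use w in \<open>auto intro!: derivative_eq_intros simp: field_simps\<close>)
  qed
qed

text \<open>For the ansatz \<open>1 + a E + b E^2\<close> the relation
  \<open>E^3 = - \<kappa> E\<close> gives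
  \<open>E ** \<gamma> t = (1 - \<kappa> b) E + a E^2\<close>; comparing coefficients yields the
  system a' = 1 - \<kappa> b, b' = a.\<close>

lemma matrix_flow_exists:
  fixes E :: "real^'n^'n"
  assumes E: "E ** (E ** E) = (- \<kappa>) *\<^sub>R E"
  obtains \<gamma> :: "real \<Rightarrow> real^'n^'n" where "smooth_on UNIV \<gamma>" "\<gamma> 0 = mat 1"
    "\<And>t. (\<gamma> has_vector_derivative E ** \<gamma> t) (at t)" "\<And>t. \<gamma> t ** E = E ** \<gamma> t"
proof -
  obtain a b :: "real \<Rightarrow> real" where ab: "a 0 = 0" "b 0 = 0"
    "\<And>t. (a has_real_derivative 1 - \<kappa> * b t) (at t)" "\<And>t. (b has_real_derivative a t) (at t)"
    using generalized_sine_exists by blast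
  have a': "(a has_derivative (\<lambda>v. v + (- \<kappa> * v) * b t)) (at t)" for t
    by (rule has_derivative_eq_rhs[OF ab(3)[unfolded has_field_derivative_def]])
      (simp add: algebra_simps fun_eq_iff)
  have b': "(b has_derivative (\<lambda>v. a t * v)) (at t)" for t
    using ab(4) by (simp add: has_field_derivative_def)
  \<comment> \<open>The induction treats both functions at once, since the derivative of each is
    expressed by the other.\<close>
  have "k_times_differentiable_on k UNIV a \<and> k_times_differentiable_on k UNIV b" for k
  proof (induction k)
    case 0
    show ?case
      using ab(3,4) by (auto intro!: continuous_at_imp_continuous_on DERIV_isCont)
  next
    case (Suc k)
    have "k_times_differentiable_on k UNIV (\<lambda>t. v + (- \<kappa> * v) * b t)" for v
      using Suc k_times_differentiable_on_const k_times_differentiable_on_const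
      by (intro k_times_differentiable_on_add k_times_differentiable_on_bilinear[OF _ bounded_bilinear_mult]) auto
    moreover have "k_times_differentiable_on k UNIV (\<lambda>t. a t * v)" for v
      using Suc k_times_differentiable_on_const
      by (intro k_times_differentiable_on_bilinear[OF _ bounded_bilinear_mult]) auto
    ultimately show ?case
      by (intro conjI k_times_differentiable_on_SucI[OF open_UNIV a'] k_times_differentiable_on_SucI[OF open_UNIV b'])
  qed
  then have smooth: "smooth_on UNIV a" "smooth_on UNIV b" by (auto simp: smooth_on_def)
  define \<gamma> where "\<gamma> t = mat 1 + a t *\<^sub>R E + b t *\<^sub>R (E ** E)" for t
  show ?thesis
  proof (rule that[of \<gamma>])
    show "smooth_on UNIV \<gamma>"
      unfolding \<gamma>_def using smooth
      by (intro smooth_on_add smooth_on_bilinear[OF _ bounded_bilinear_scaleR] smooth_on_const open_UNIV)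
    show "\<gamma> 0 = mat 1" by (simp add: \<gamma>_def ab)
    show "\<gamma> t ** E = E ** \<gamma> t" for t
      by (simp add: \<gamma>_def matrix_mult_linear_simps matrix_mul_assoc)
    have "(\<gamma> has_vector_derivative (1 - \<kappa> * b t) *\<^sub>R E + a t *\<^sub>R (E ** E)) (at t)" for t
      unfolding \<gamma>_def
      by (rule derivative_eq_intros ab(3,4) | simp)+
    moreover have "E ** \<gamma> t = (1 - \<kappa> * b t) *\<^sub>R E + a t *\<^sub>R (E ** E)" for t
      by (simp add: \<gamma>_def matrix_mult_linear_simps E algebra_simps)
    ultimately show "(\<gamma> has_vector_derivative E ** \<gamma> t) (at t)" for t by simp
  qed
qed

text \<open>As \<open>E\<close> commutes with the flow,
  \<open>\<gamma> (- s) ** \<gamma> (s + t)\<close> is constant in \<open>s\<close>, equal to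
  \<open>\<gamma> t\<close>. The case \<open>t = 0\<close> shows that \<open>\<gamma> (- s)\<close>
  is the inverse of \<open>\<gamma> s\<close>.\<close>

lemma matrix_flow_add:
  fixes \<gamma> :: "real \<Rightarrow> real^'n^'n"
  assumes \<gamma>: "\<gamma> 0 = mat 1" "\<And>t. (\<gamma> has_vector_derivative E ** \<gamma> t) (at t)" "\<And>t. \<gamma> t ** E = E ** \<gamma> t"
  shows "\<gamma> (s + t) = \<gamma> s ** \<gamma> t"
proof -
  have shift: "((\<lambda>s. \<gamma> (s + t)) has_vector_derivative E ** \<gamma> (s + t)) (at s)" for s t
  proof -
    have "((\<lambda>s. s + t) has_vector_derivative 1) (at s)" by (auto intro!: derivative_eq_intros)
    from vector_diff_chain_at[OF this \<gamma>(2)] show ?thesis by (simp add: comp_def)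
  qed
  have minus: "((\<lambda>s. \<gamma> (- s)) has_vector_derivative - (E ** \<gamma> (- s))) (at s)" for s
  proof -
    have "((\<lambda>s. - s :: real) has_vector_derivative - 1) (at s)" by (auto intro!: derivative_eq_intros)
    from vector_diff_chain_at[OF this \<gamma>(2)] show ?thesis by (simp add: comp_def)
  qed
  have const: "\<gamma> (- s) ** \<gamma> (s + t) = \<gamma> t" for s t
  proof -
    have "((\<lambda>s. \<gamma> (- s) ** \<gamma> (s + t)) has_vector_derivative
        \<gamma> (- s) ** (E ** \<gamma> (s + t)) + - (E ** \<gamma> (- s)) ** \<gamma> (s + t)) (at s)" for s
      by (rule bounded_bilinear.has_vector_derivative[OF bounded_bilinear_matrix_matrix_mult minus shift])
    then have "((\<lambda>s. \<gamma> (- s) ** \<gamma> (s + t)) has_vector_derivative 0) (at s)" for s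
      by (simp add: matrix_mult_linear_simps matrix_mul_assoc \<gamma>(3))
    then obtain c where c: "\<And>s. \<gamma> (- s) ** \<gamma> (s + t) = c"
      using has_vector_derivative_zero_constant[of UNIV "\<lambda>s. \<gamma> (- s) ** \<gamma> (s + t)"] by auto
    from c[of 0] c[of s] show ?thesis by (simp add: \<gamma>(1))
  qed
  have "\<gamma> s ** \<gamma> (- s) = mat 1" using const[of "- s" 0] by (simp add: \<gamma>(1))
  then show ?thesis
    using const[of s t] by (metis matrix_mul_assoc matrix_mul_lid)
qed

text \<open>The pulled-back form has derivative \<open>transpose (\<gamma> t) ** (A ** E + transpose
  E ** A) ** \<gamma> t = 0\<close> and equals \<open>A\<close> at time 0.\<close>

lemma matrix_flow_isometry:
  fixes \<gamma> :: "real \<Rightarrow> real^'n^'n"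
  assumes \<gamma>: "\<gamma> 0 = mat 1" "\<And>t. (\<gamma> has_vector_derivative E ** \<gamma> t) (at t)"
    and E: "A ** E + transpose E ** A = 0"
  shows "\<gamma> t \<in> isometries A"
proof -
  have T: "((\<lambda>t. transpose (\<gamma> t)) has_vector_derivative transpose (\<gamma> t) ** transpose E) (at t)" for t
    using bounded_linear.has_vector_derivative[OF linear_conv_bounded_linear[THEN iffD1, OF linear_transpose] \<gamma>(2)]
    by (simp add: matrix_transpose_mul)
  have "((\<lambda>t. transpose (\<gamma> t) ** (A ** \<gamma> t)) has_vector_derivative
     transpose (\<gamma> t) ** (A ** (E ** \<gamma> t)) + transpose (\<gamma> t) ** transpose E ** (A ** \<gamma> t)) (at t)" for t
    by (intro bounded_bilinear.has_vector_derivative[OF bounded_bilinear_matrix_matrix_mult] T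
        bounded_linear.has_vector_derivative[OF
          bounded_bilinear.bounded_linear_right[OF bounded_bilinear_matrix_matrix_mult]] \<gamma>(2))
  moreover have "transpose (\<gamma> t) ** (A ** (E ** \<gamma> t)) + transpose (\<gamma> t) ** transpose E ** (A ** \<gamma> t)
      = transpose (\<gamma> t) ** (A ** E + transpose E ** A) ** \<gamma> t" for t
    by (simp add: matrix_mult_linear_simps matrix_mul_assoc)
  ultimately have "((\<lambda>t. transpose (\<gamma> t) ** (A ** \<gamma> t)) has_vector_derivative 0) (at t)" for t
    by (simp add: E matrix_mult_linear_simps)
  then obtain c where c: "\<And>t. transpose (\<gamma> t) ** (A ** \<gamma> t) = c"
    using has_vector_derivative_zero_constant[of UNIV "\<lambda>t. transpose (\<gamma> t) ** (A ** \<gamma> t)"] by auto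
  from c[of 0] c[of t] show ?thesis by (simp add: \<gamma>(1) isometries_def matrix_mul_assoc)
qed

lemma cayley_hamilton_3:
  fixes E :: "real^3^3"
  assumes "trace E = 0" "det E = 0"
  obtains \<kappa> where "E ** (E ** E) = (- \<kappa>) *\<^sub>R E"
proof -
  \<comment> \<open>The sum of the principal 2 by 2 minors, the linear coefficient of the
    characteristic polynomial.\<close>
  define \<kappa> where "\<kappa> = E$1$1 * E$2$2 - E$1$2 * E$2$1 + E$1$1 * E$3$3 - E$1$3 * E$3$1 + E$2$2 * E$3$3 - E$2$3 * E$3$2"
  have "E ** (E ** E) - trace E *\<^sub>R (E ** E) + \<kappa> *\<^sub>R E - det E *\<^sub>R mat 1 = 0"
    by (simp add: vec_eq_iff forall_3 matrix_matrix_mult_def sum_3 trace_def det_3 \<kappa>_def mat_def)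
      (simp add: algebra_simps)
  then have "E ** (E ** E) = (- \<kappa>) *\<^sub>R E" using assms by (simp add: eq_neg_iff_add_eq_0)
  then show ?thesis by (rule that)
qed

text \<open>The trace of a skew times a symmetric matrix vanishes, and so does the determinant of a
  skew matrix of odd size; the characteristic equation is left with its cubic and linear
  terms.\<close>

lemma skew_mult_symmetric_flow:
  assumes A: "transpose A = A"
  obtains \<gamma> :: "real \<Rightarrow> real^3^3" where "smooth_on UNIV \<gamma>" "\<gamma> 0 = mat 1"
    "\<And>t. (\<gamma> has_vector_derivative (skew s ** A) ** \<gamma> t) (at t)"
    "\<And>t. \<gamma> t \<in> isometries A" "\<And>t u. \<gamma> (t + u) = \<gamma> t ** \<gamma> u"
proof -
  have sym: "A $ j $ i = A $ i $ j" for i j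
    using arg_cong[OF A, of "\<lambda>M. M $ i $ j"] by (simp add: transpose_def)
  have "trace (skew s ** A) = 0"
    using sym[of 1 2] sym[of 1 3] sym[of 2 3]
    by (simp add: trace_def matrix_matrix_mult_def sum_3 skew_def algebra_simps)
  moreover have "det (skew s ** A) = 0"
    by (simp add: det_mul) (simp add: det_3 skew_def)
  ultimately obtain \<kappa> where "skew s ** A ** (skew s ** A ** (skew s ** A)) = (- \<kappa>) *\<^sub>R (skew s ** A)"
    using cayley_hamilton_3 by blast
  then obtain \<gamma> where \<gamma>: "smooth_on UNIV \<gamma>" "\<gamma> 0 = mat 1"
    "\<And>t. (\<gamma> has_vector_derivative (skew s ** A) ** \<gamma> t) (at t)" "\<And>t. \<gamma> t ** (skew s ** A) = skew s ** A ** \<gamma> t"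
    using matrix_flow_exists by blast
  show ?thesis
    by (rule that[OF \<gamma>(1-3) matrix_flow_isometry[OF \<gamma>(2,3) skew_infinitesimal_isometry[OF A]]
          matrix_flow_add[OF \<gamma>(2-4)]])
qed

section \<open>The Lie algebra\<close>

text \<open>Differentiating \<open>c \<circ> \<phi> \<circ> \<gamma> = \<gamma>\<close>, valid near
  0, relates the velocity in the chart to the matrix velocity by a linear map.\<close>

lemma embedded_chart_curve_derivative:
  assumes ch: "embedded_chart G U \<phi> W D c"
    and \<gamma>: "smooth_on UNIV \<gamma>" "\<And>t :: real. \<gamma> t \<in> G" "\<gamma> 0 \<in> U" "(\<gamma> has_vector_derivative E) (at 0)"
  shows "frechet_derivative c (at (\<phi> (\<gamma> 0))) (vector_derivative (\<phi> \<circ> \<gamma>) (at 0)) = E"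
proof -
  note ch = embedded_chartD[OF ch]
  have W: "\<gamma> 0 \<in> W" using \<gamma>(3) ch(2) by blast
  have "open (\<gamma> -` W)"
    using smooth_on_imp_continuous_on[OF \<gamma>(1)] ch(1) by (intro open_vimage) auto
  then have op: "open (\<gamma> -` W)" "0 \<in> \<gamma> -` W" using W by auto
  have "\<phi> differentiable at (\<gamma> 0)" by (rule smooth_on_imp_differentiable[OF ch(4) W])
  then have "((\<lambda>t. \<phi> (\<gamma> t)) has_derivative (\<lambda>t. frechet_derivative \<phi> (at (\<gamma> 0)) (t *\<^sub>R E))) (at 0)"
    using has_derivative_compose[of \<gamma> "\<lambda>t. t *\<^sub>R E" 0 UNIV \<phi>] \<gamma>(4)
    by (simp add: has_vector_derivative_def has_derivative_frechet)
  then have "(\<phi> \<circ> \<gamma>) differentiable at 0" by (auto simp: differentiable_def comp_def)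
  then have v: "((\<phi> \<circ> \<gamma>) has_vector_derivative vector_derivative (\<phi> \<circ> \<gamma>) (at 0)) (at 0)"
    by (simp add: vector_derivative_works)
  have "c differentiable at ((\<phi> \<circ> \<gamma>) 0)"
    using smooth_on_imp_differentiable[OF ch(5) ch(6)[OF \<gamma>(3)]] by simp
  then have "(c \<circ> (\<phi> \<circ> \<gamma>) has_vector_derivative
      frechet_derivative c (at ((\<phi> \<circ> \<gamma>) 0)) (vector_derivative (\<phi> \<circ> \<gamma>) (at 0))) (at 0)"
    by (intro vector_derivative_diff_chain_within[OF v] has_derivative_at_withinI[OF has_derivative_frechet])
  then have "(\<gamma> has_vector_derivative
      frechet_derivative c (at ((\<phi> \<circ> \<gamma>) 0)) (vector_derivative (\<phi> \<circ> \<gamma>) (at 0))) (at 0)"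
    by (rule has_vector_derivative_transform_within_open[OF _ op]) (use \<gamma>(2) ch(2,7) in auto)
  then show ?thesis using \<gamma>(4) vector_derivative_unique_at by fastforce
qed

text \<open>A relation among the chart velocities is carried by the derivative of the
  parametrization to one among the matrices \<open>skew (axis i 1) ** A\<close>; cancelling
  \<open>A\<close> makes its coefficients vanish. Three independent vectors form a basis of
  R^3.\<close>

lemma lie_algebra_basis_isometry_group:
  assumes A: "transpose A = A" "det A \<noteq> 0"
    and smooth: "\<And>i. smooth_on UNIV (\<gamma> i)" and one: "\<And>i. \<gamma> i 0 = mat 1"
    and deriv: "\<And>i. (\<gamma> i has_vector_derivative skew (axis i 1) ** A) (at 0)"
    and iso: "\<And>i t. \<gamma> i t \<in> isometries A" and add: "\<And>i t u. \<gamma> i (t + u) = \<gamma> i t ** \<gamma> i u"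
  shows "lie_algebra_basis (isometry_group A) (isometry_manifold A) \<gamma>"
  unfolding lie_algebra_basis_def
proof (intro conjI allI)
  note M = embedded_isometry_manifold[OF A]
  show "one_parameter_subgroup (isometry_group A) (isometry_manifold A) (\<gamma> i)" for i
    unfolding one_parameter_subgroup_def
  proof (intro conjI allI)
    show "smooth_map euclidean_manifold (isometry_manifold A) (\<gamma> i)"
      by (rule smooth_map_embedded[OF embedded_manifold_euclidean M open_UNIV smooth]) (use iso in auto)
  qed (use iso add in \<open>auto simp: isometry_group_def\<close>)
  show "\<forall>(U, \<phi>)\<in>charts (isometry_manifold A). \<one>\<^bsub>isometry_group A\<^esub> \<in> U \<longrightarrow>
    (let v = \<lambda>i. vector_derivative (\<phi> \<circ> \<gamma> i) (at 0)
     in inj v \<and> independent (range v) \<and> span (range v) = UNIV)"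
  proof (clarify)
    fix U \<phi> assume "(U, \<phi>) \<in> charts (isometry_manifold A)" and U: "\<one>\<^bsub>isometry_group A\<^esub> \<in> U"
    then obtain W D c where ch: "embedded_chart (isometries A) U \<phi> W D c"
      using embedded_manifold_chart[OF M] by metis
    define v where "v = (\<lambda>i. vector_derivative (\<phi> \<circ> \<gamma> i) (at 0))"
    let ?L = "frechet_derivative c (at (\<phi> (mat 1)))"
    have U: "mat 1 \<in> U" using U by (simp add: isometry_group_def)
    then have L: "?L (v i) = skew (axis i 1) ** A" for i
      using embedded_chart_curve_derivative[OF ch smooth iso _ deriv, of i] by (simp add: one v_def)
    have "bounded_linear ?L"
      by (rule has_derivative_bounded_linear[OF has_derivative_frechet[OF
            smooth_on_imp_differentiable[OF embedded_chartD(5)[OF ch] embedded_chartD(6)[OF ch U]]]])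
    then have lin: "linear ?L" by (rule bounded_linear.linear)
    have "\<forall>i. x i = 0" if "(\<Sum>i\<in>UNIV. x i *\<^sub>R v i) = 0" for x
    proof -
      have "skew (\<chi> i. x i) ** A = (\<Sum>i\<in>UNIV. x i *\<^sub>R (skew (axis i 1) ** A))"
        unfolding sum_3 by (simp flip: matrix_mult_linear_simps)
          (rule arg_cong[of _ _ "\<lambda>M. M ** A"], simp add: skew_def vec_eq_iff forall_3 axis_def)
      also have "\<dots> = ?L (\<Sum>i\<in>UNIV. x i *\<^sub>R v i)"
        by (simp add: linear_sum[OF lin] linear_scale[OF lin] L)
      also have "\<dots> = 0" using that lin by (simp add: linear_0)
      finally have "skew (\<chi> i. x i) ** A ** matrix_inv A = 0" by (simp add: matrix_mult_linear_simps)
      then have "skew (\<chi> i. x i) = 0"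
        by (simp add: matrix_mul_assoc[symmetric] det_nz_matrix_inv[OF A(2)])
      then have "(\<chi> i. x i) = unskew 0" by (metis unskew_skew)
      then show ?thesis by (simp add: unskew_def vec_eq_iff forall_3)
    qed
    then show "let v = \<lambda>i. vector_derivative (\<phi> \<circ> \<gamma> i) (at 0)
        in inj v \<and> independent (range v) \<and> span (range v) = UNIV"
      unfolding Let_def v_def[symmetric] using basis_of_linear_independent by blast
  qed
qed

section \<open>Orbits\<close>

lemma dot_symmetric_matrix:
  fixes A :: "real^'n^'n"
  assumes "transpose A = A" shows "x \<bullet> (A *v y) = y \<bullet> (A *v x)"
  by (metis assms dot_lmul_matrix inner_commute transpose_matrix_vector)

lemma dot_transpose: "(g *v x) \<bullet> y = x \<bullet> (transpose g *v y)"
  for g :: "real^'n^'m"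
  by (subst dot_lmul_matrix[symmetric]) (simp only: vector_transpose_matrix)

lemma isometriesI:
  fixes A :: "real^'n^'n"
  assumes "\<And>x y. (g *v x) \<bullet> (A *v (g *v y)) = x \<bullet> (A *v y)"
  shows "g \<in> isometries A"
proof -
  have "x \<bullet> ((transpose g ** A ** g) *v y) = x \<bullet> (A *v y)" for x y
    using assms[of x y]
    by (simp only: dot_transpose matrix_vector_mul_assoc matrix_mul_assoc)
  then have "(transpose g ** A ** g) *v y = A *v y" for y
    by (metis vector_eq_ldot)
  then show ?thesis by (simp add: isometries_def matrix_eq)
qed

lemma isometries_dot:
  fixes A :: "real^'n^'n"
  assumes "g \<in> isometries A" shows "(g *v x) \<bullet> (A *v (g *v y)) = x \<bullet> (A *v y)"
proof -
  have "(g *v x) \<bullet> (A *v (g *v y)) = x \<bullet> ((transpose g ** A ** g) *v y)"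
    by (simp only: dot_transpose matrix_vector_mul_assoc matrix_mul_assoc)
  with assms show ?thesis by (simp add: isometries_def)
qed

text \<open>The reflection in the \<open>A\<close>-orthogonal complement of
  \<open>n = p - q\<close>, possible as \<open>n\<close> is not isotropic. Equality of the two
  values gives \<open>N = 2 (n \<bullet> (A *v p))\<close>, so \<open>p\<close> goes to
  \<open>p - n = q\<close>.\<close>

lemma reflection_isometry:
  fixes A :: "real^'n^'n"
  assumes A: "transpose A = A" and eq: "p \<bullet> (A *v p) = q \<bullet> (A *v q)"
    and nz: "(p - q) \<bullet> (A *v (p - q)) \<noteq> 0"
  shows "\<exists>g\<in>isometries A. g *v p = q"
proof -
  define n where "n = p - q"
  define N where "N = n \<bullet> (A *v n)"
  define r where "r x = x - (2 * (n \<bullet> (A *v x)) / N) *\<^sub>R n" for x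
  have N: "N \<noteq> 0" using nz by (simp add: N_def n_def)
  have lin: "linear r"
    by (rule linearI) (simp_all add: r_def matrix_vector_right_distrib inner_add_right add_divide_distrib
        scaleR_left_distrib algebra_simps matrix_vector_mult_scaleR)
  have r: "matrix r *v x = r x" for x by (rule matrix_works) (use lin in \<open>simp add: linear_matrix_vector_mul_eq\<close>)
  have "r x \<bullet> (A *v r y) = x \<bullet> (A *v y)" for x y
  proof -
    define a b where "a = n \<bullet> (A *v x)" and "b = n \<bullet> (A *v y)"
    have "(x - c *\<^sub>R n) \<bullet> (A *v (y - d *\<^sub>R n)) = x \<bullet> (A *v y) - d * (x \<bullet> (A *v n)) - c * b + c * (d * N)" for c d
      unfolding b_def N_def
      by (simp add: matrix_vector_mult_diff_distrib matrix_vector_mult_scaleR inner_diff_left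
          inner_diff_right algebra_simps)
    then have "r x \<bullet> (A *v r y) = x \<bullet> (A *v y) - (2 * b / N) * (x \<bullet> (A *v n)) - (2 * a / N) * b
        + (2 * a / N) * ((2 * b / N) * N)"
      unfolding r_def a_def b_def by blast
    moreover have "x \<bullet> (A *v n) = a" unfolding a_def by (rule dot_symmetric_matrix[OF A])
    ultimately show ?thesis using N by (simp add: field_simps)
  qed
  then have "matrix r \<in> isometries A" by (intro isometriesI) (simp add: r)
  moreover have "r p = q"
  proof -
    have "N = 2 * (n \<bullet> (A *v p))"
      using eq dot_symmetric_matrix[OF A, of q p]
      by (simp add: N_def n_def matrix_vector_mult_diff_distrib inner_diff_left inner_diff_right)
    then have "2 * (n \<bullet> (A *v p)) / N = 1" using N by simp
    then show ?thesis by (simp add: r_def n_def)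
  qed
  ultimately show ?thesis using r by metis
qed

text \<open>If \<open>p - q\<close> and \<open>p + q\<close> are isotropic, then so are \<open>p\<close> and \<open>q\<close>, and one passes through an
  isotropic vector that is orthogonal to neither of them.\<close>

lemma isometries_transitive:
  fixes A :: "real^'n^'n"
  assumes A: "transpose A = A" "det A \<noteq> 0" and eq: "p \<bullet> (A *v p) = q \<bullet> (A *v q)"
    and p: "p \<noteq> 0" and q: "q \<noteq> 0"
  shows "\<exists>g\<in>isometries A. g *v p = q"
proof -
  note sym = dot_symmetric_matrix[OF A(1)]
  note expand = matrix_vector_mult_diff_distrib matrix_vector_right_distrib inner_diff_left
    inner_diff_right inner_add_left inner_add_right
  consider "(p - q) \<bullet> (A *v (p - q)) \<noteq> 0" | "(p + q) \<bullet> (A *v (p + q)) \<noteq> 0"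
    | "(p - q) \<bullet> (A *v (p - q)) = 0" "(p + q) \<bullet> (A *v (p + q)) = 0" by blast
  then show ?thesis
  proof cases
    case 1
    then show ?thesis by (rule reflection_isometry[OF A(1) eq])
  next
    case 2
    \<comment> \<open>If \<open>p + q\<close> is not isotropic, reflect \<open>p\<close> to
      \<open>- q\<close> and use that negation preserves the form.\<close>
    have "\<exists>g\<in>isometries A. g *v p = - q"
    proof (rule reflection_isometry[OF A(1)])
      have "A *v (- q) = - (A *v q)"
        using matrix_vector_mult_diff_distrib[of A 0 q] by simp
      then show "p \<bullet> (A *v p) = (- q) \<bullet> (A *v (- q))" using eq by simp
    qed (use 2 in simp)
    then obtain g where g: "g \<in> isometries A" "g *v p = - q" by blast
    have "- g \<in> isometries A"
      using g(1) by (simp add: isometries_def transpose_linear_simps matrix_mult_linear_simps)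
    moreover have "(- g) *v p = q"
      using g(2) bounded_bilinear.minus_left[OF bounded_bilinear_matrix_vector_mult, of g p] by simp
    ultimately show ?thesis by blast
  next
    case 3
    \<comment> \<open>Adding the two isotropy equations gives twice the sum of the values at
      \<open>p\<close> and \<open>q\<close>, which are equal.\<close>
    have pp: "p \<bullet> (A *v p) = 0" and qq: "q \<bullet> (A *v q) = 0"
      using 3 eq by (simp_all add: expand)
    have nz: "A *v y \<noteq> 0" if "y \<noteq> 0" for y
      using that det_nz_matrix_inv(2)[OF A(2)]
      by (metis matrix_vector_mul_assoc matrix_vector_mul_lid matrix_vector_mult_0_right)
    \<comment> \<open>If the vectors \<open>A *v p\<close> and \<open>A *v q\<close> are
      perpendicular in the Euclidean sense, their sum pairs with each to a positive square;
      otherwise \<open>A *v p\<close> itself serves.\<close>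
    obtain x where x: "x \<bullet> (A *v p) \<noteq> 0" "x \<bullet> (A *v q) \<noteq> 0"
    proof (cases "(A *v p) \<bullet> (A *v q) = 0")
      case True
      then show ?thesis
        using that[of "A *v p + A *v q"] nz[OF p] nz[OF q] by (simp add: inner_add_left inner_add_right inner_commute)
    next
      case False
      then show ?thesis using that[of "A *v p"] nz[OF p] by simp
    qed
    \<comment> \<open>As \<open>p\<close> is isotropic, the form at \<open>x - t p\<close> is affine
      in \<open>t\<close>, and this \<open>t\<close> is its zero. Since \<open>p\<close> is also
      orthogonal to \<open>q\<close>, the pairings of \<open>x\<close> with \<open>p\<close> and
      \<open>q\<close> survive.\<close>
    define r where "r = x - (x \<bullet> (A *v x) / (2 * (x \<bullet> (A *v p)))) *\<^sub>R p"
    have pq: "p \<bullet> (A *v q) = 0" using 3 pp qq sym[of q p] by (simp add: expand)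
    have rp: "r \<bullet> (A *v p) = x \<bullet> (A *v p)" and rq: "r \<bullet> (A *v q) = x \<bullet> (A *v q)"
      by (simp_all add: r_def expand pp pq)
    have rr: "r \<bullet> (A *v r) = 0"
      using x(1) by (simp add: r_def expand matrix_vector_mult_scaleR pp sym[of p x])
    \<comment> \<open>Both vectors are isotropic, so the form at \<open>p - r\<close> is minus twice
      their pairing, which is nonzero.\<close>
    have "\<exists>g\<in>isometries A. g *v p = r"
      using x rp rr pp sym[of p r] by (intro reflection_isometry A) (simp_all add: expand)
    moreover have "\<exists>g\<in>isometries A. g *v r = q"
      using x rq rr qq sym[of q r] by (intro reflection_isometry A) (simp_all add: expand)
    ultimately obtain g h where "g \<in> isometries A" "g *v p = r" "h \<in> isometries A" "h *v r = q"
      by blast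
    then show ?thesis
      by (intro bexI[of _ "h ** g"]) (auto simp: isometries_mult matrix_vector_mul_assoc[symmetric])
  qed
qed

lemma isometry_orbit:
  fixes A :: "real^'n^'n"
  assumes A: "transpose A = A" "det A \<noteq> 0" and p: "p \<noteq> 0"
  shows "orbit (isometry_group A) (*v) p = {q. q \<bullet> (A *v q) = p \<bullet> (A *v p)} - {0}"
proof -
  have "g *v p \<noteq> 0" if "g \<in> isometries A" for g
    using p det_nz_matrix_inv(2)[OF isometries_det[OF A(2) that]]
    by (metis matrix_vector_mul_assoc matrix_vector_mul_lid matrix_vector_mult_0_right)
  moreover have "q \<in> orbit (isometry_group A) (*v) p" if "q \<bullet> (A *v q) = p \<bullet> (A *v p)" "q \<noteq> 0" for q
    using isometries_transitive[OF A that(1)[symmetric] p that(2)]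
    by (auto simp: orbit_def isometry_group_def)
  ultimately show ?thesis by (auto simp: orbit_def isometry_group_def isometries_dot)
qed

lemma isometry_orbit_zero:
  fixes A :: "real^'n^'n"
  shows "orbit (isometry_group A) (*v) 0 = {0}"
  using isometries_one[of A] by (auto simp: orbit_def isometry_group_def)

lemma quad_eq_dot:
  assumes "transpose A = A" shows "quad A p = p \<bullet> (A *v p) / 2"
proof -
  have sym: "A $ j $ i = A $ i $ j" for i j
    using arg_cong[OF assms, of "\<lambda>M. M $ i $ j"] by (simp add: transpose_def)
  show ?thesis
    using sym[of 1 2] sym[of 1 3] sym[of 2 3]
    by (simp add: quad_def inner_vec_def matrix_vector_mult_def sum_3 algebra_simps power2_eq_square)
qed

section \<open>Commutators of linear vector fields\<close>

text \<open>Each iterated derivation is a first-order term plus the second derivative at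
  \<open>P *v p\<close> and \<open>Q *v p\<close>; the latter cancel by symmetry. The inner field is
  differentiated along the outer one, whence the order \<open>Q ** P - P ** Q\<close>.\<close>

lemma commutator_linear_fields:
  fixes P Q :: "real^'n^'n" and g :: "real^'n \<Rightarrow> real"
  assumes g: "smooth_on UNIV g"
  shows "commutator (\<lambda>p. P *v p) (\<lambda>p. Q *v p) g = (\<lambda>p. frechet_derivative g (at p) ((Q ** P - P ** Q) *v p))"
proof
  fix p
  define H where "H u v = frechet_derivative (\<lambda>x. frechet_derivative g (at x) u) (at p) v" for u v
  have lin: "linear (frechet_derivative g (at x))" for x
    by (intro bounded_linear.linear has_derivative_bounded_linear[OF has_derivative_frechet]
        smooth_on_imp_differentiable[OF g]) simp
  have dH: "((\<lambda>x. frechet_derivative g (at x) u) has_derivative H u) (at p)" for u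
    unfolding H_def by (intro has_derivative_frechet smooth_on_imp_differentiable[OF smooth_on_derivative[OF g]]) simp
  have linH: "linear (H u)" for u by (intro bounded_linear.linear has_derivative_bounded_linear[OF dH])
  have symH: "H u v = H v u" for u v unfolding H_def by (rule second_derivative_symmetric[OF g])
  have expand: "f w = (\<Sum>b\<in>Basis. (w \<bullet> b) * f b)" if "linear f" for f :: "real^'n \<Rightarrow> real" and w
    using linear_sum[OF that, of "\<lambda>b. (w \<bullet> b) *\<^sub>R b" Basis]
    by (simp add: linear_scale[OF that] euclidean_representation)
  have D: "derivation (\<lambda>p. P *v p) (derivation (\<lambda>p. Q *v p) g) p =
      frechet_derivative g (at p) (Q *v (P *v p)) + H (P *v p) (Q *v p)" for P Q :: "real^'n^'n"
  proof -
    \<comment> \<open>The direction \<open>Q *v x\<close> moves with \<open>x\<close>; expanding it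
      in the basis leaves derivatives of \<open>g\<close> in fixed directions.\<close>
    have "((\<lambda>x. \<Sum>b\<in>Basis. ((Q *v x) \<bullet> b) * frechet_derivative g (at x) b) has_derivative
        (\<lambda>v. \<Sum>b\<in>Basis. ((Q *v p) \<bullet> b) * H b v + ((Q *v v) \<bullet> b) * frechet_derivative g (at p) b)) (at p)"
      by (intro has_derivative_sum has_derivative_mult dH has_derivative_inner_left
          bounded_linear_imp_has_derivative matrix_vector_mul_bounded_linear)
    moreover have "derivation (\<lambda>p. Q *v p) g = (\<lambda>x. \<Sum>b\<in>Basis. ((Q *v x) \<bullet> b) * frechet_derivative g (at x) b)"
      unfolding derivation_def by (rule ext) (rule expand[OF lin])
    ultimately have "derivation (\<lambda>p. P *v p) (derivation (\<lambda>p. Q *v p) g) p =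
       (\<Sum>b\<in>Basis. ((Q *v p) \<bullet> b) * H b (P *v p) + ((Q *v (P *v p)) \<bullet> b) * frechet_derivative g (at p) b)"
      unfolding derivation_def[of "\<lambda>p. P *v p"] by (simp add: frechet_derivative_eqI)
    also have "\<dots> = (\<Sum>b\<in>Basis. ((Q *v p) \<bullet> b) * H (P *v p) b)
        + (\<Sum>b\<in>Basis. ((Q *v (P *v p)) \<bullet> b) * frechet_derivative g (at p) b)"
      by (simp add: sum.distrib symH[of _ "P *v p"])
    also have "\<dots> = H (P *v p) (Q *v p) + frechet_derivative g (at p) (Q *v (P *v p))"
      by (simp only: expand[OF lin, symmetric] expand[OF linH, symmetric])
    finally show ?thesis by simp
  qed
  show "commutator (\<lambda>p. P *v p) (\<lambda>p. Q *v p) g p = frechet_derivative g (at p) ((Q ** P - P ** Q) *v p)"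
    unfolding commutator_def D symH[of "Q *v p"]
    by (simp add: matrix_vector_mult_diff_rdistrib linear_diff[OF lin] matrix_vector_mul_assoc)
qed

section \<open>The fields of the quadratic form\<close>

lemma quadric_field_eq: "quadric_field A i = (\<lambda>p. (skew (axis i 1) ** A) *v p)"
proof
  fix p
  have A: "A *v p = vector [lin A 1 p, lin A 2 p, lin A 3 p]"
    by (simp add: lin_def matrix_vector_mult_def sum_3 vec_eq_iff forall_3)
  have "quadric_field A i p = skew (axis i 1) *v vector [lin A 1 p, lin A 2 p, lin A 3 p]"
    using exhaust_3[of i]
    by (auto simp: quadric_field_explicit skew_def matrix_vector_mult_def sum_3 vec_eq_iff forall_3 axis_def)
  then show "quadric_field A i p = (skew (axis i 1) ** A) *v p"
    by (simp add: A matrix_vector_mul_assoc[symmetric])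
qed

lemma commutator_quadric_fields:
  assumes A: "transpose A = A" and g: "smooth_on UNIV g"
  shows "commutator (quadric_field A 1) (quadric_field A 2) g = (\<lambda>p. \<Sum>k\<in>UNIV. A$3$k * derivation (quadric_field A k) g p)"
    "commutator (quadric_field A 2) (quadric_field A 3) g = (\<lambda>p. \<Sum>k\<in>UNIV. A$1$k * derivation (quadric_field A k) g p)"
    "commutator (quadric_field A 3) (quadric_field A 1) g = (\<lambda>p. \<Sum>k\<in>UNIV. A$2$k * derivation (quadric_field A k) g p)"
proof -
  define E where "E i = skew (axis i 1) ** A" for i
  have X: "quadric_field A i = (\<lambda>p. E i *v p)" for i unfolding quadric_field_eq E_def ..
  have sym: "A $ j $ i = A $ i $ j" for i j
    using arg_cong[OF A, of "\<lambda>M. M $ i $ j"] by (simp add: transpose_def)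
  \<comment> \<open>Behind this is \<open>skew t ** A ** skew s - skew s ** A ** skew t = skew (A *v
    w)\<close>, with w the cross product of \<open>s\<close> and \<open>t\<close>; for pairs of axis
    vectors \<open>A *v w\<close> is a row of the symmetric \<open>A\<close>.\<close>
  have bracket: "E 2 ** E 1 - E 1 ** E 2 = (\<Sum>k\<in>UNIV. A$3$k *\<^sub>R E k)"
    "E 3 ** E 2 - E 2 ** E 3 = (\<Sum>k\<in>UNIV. A$1$k *\<^sub>R E k)"
    "E 1 ** E 3 - E 3 ** E 1 = (\<Sum>k\<in>UNIV. A$2$k *\<^sub>R E k)"
    unfolding E_def using sym[of 1 2] sym[of 1 3] sym[of 2 3]
    by (simp_all add: skew_def matrix_matrix_mult_def sum_3 vec_eq_iff forall_3 axis_def algebra_simps)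
  have *: "commutator (quadric_field A i) (quadric_field A j) g = (\<lambda>p. \<Sum>k\<in>UNIV. c k * derivation (quadric_field A k) g p)"
    if "E j ** E i - E i ** E j = (\<Sum>k\<in>UNIV. c k *\<^sub>R E k)" for i j c
  proof -
    have lin: "linear (frechet_derivative g (at x))" for x
      by (intro bounded_linear.linear has_derivative_bounded_linear[OF has_derivative_frechet]
          smooth_on_imp_differentiable[OF g]) simp
    have "(\<Sum>k\<in>UNIV. c k *\<^sub>R E k) *v p = (\<Sum>k\<in>UNIV. c k *\<^sub>R (E k *v p))" for p
      by (simp add: bounded_bilinear.sum_left[OF bounded_bilinear_matrix_vector_mult]
          bounded_bilinear.scaleR_left[OF bounded_bilinear_matrix_vector_mult])
    then show ?thesis
      unfolding X commutator_linear_fields[OF g] that derivation_def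
      by (simp add: linear_sum[OF lin] linear_scale[OF lin])
  qed
  show "commutator (quadric_field A 1) (quadric_field A 2) g = (\<lambda>p. \<Sum>k\<in>UNIV. A$3$k * derivation (quadric_field A k) g p)"
    "commutator (quadric_field A 2) (quadric_field A 3) g = (\<lambda>p. \<Sum>k\<in>UNIV. A$1$k * derivation (quadric_field A k) g p)"
    "commutator (quadric_field A 3) (quadric_field A 1) g = (\<lambda>p. \<Sum>k\<in>UNIV. A$2$k * derivation (quadric_field A k) g p)"
    by (rule *[OF bracket(1)] *[OF bracket(2)] *[OF bracket(3)])+
qed

text \<open>X_i is the cross product of the gradient with the i-th axis vector, so the left side is
  the cross product of the gradient with itself.\<close>

lemma quadric_fields_relation:
  "lin A 1 p *\<^sub>R quadric_field A 1 p + lin A 2 p *\<^sub>R quadric_field A 2 p + lin A 3 p *\<^sub>R quadric_field A 3 p = 0"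
  by (simp add: quadric_field_explicit vec_eq_iff forall_3)

lemma dependent_quadric_fields:
  assumes "det A \<noteq> 0" shows "dependent_over_functions (quadric_field A)"
proof -
  have "smooth_on UNIV (lin A i)" for i
  proof (rule smooth_on_linear, rule linear_conv_bounded_linear[THEN iffD1])
    show "linear (lin A i)" by (rule linearI) (simp_all add: lin_def algebra_simps)
  qed
  moreover have "\<exists>i p. lin A i p \<noteq> 0"
  proof -
    have "A \<noteq> 0" using assms by (auto simp: det_3)
    then obtain i j where ij: "A $ i $ j \<noteq> 0" by (auto simp: vec_eq_iff)
    \<comment> \<open>A nonzero entry of \<open>A\<close> gives a point where a coefficient of the
      relation is nonzero.\<close>
    have "lin A i (axis j 1) = A $ i $ j"
      using exhaust_3[of j] by (auto simp: lin_def axis_def)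
    with ij show ?thesis by metis
  qed
  moreover have "(\<Sum>i\<in>UNIV. lin A i p *\<^sub>R quadric_field A i p) = 0" for p
    using quadric_fields_relation[of A p] by (simp add: sum_3)
  ultimately show ?thesis unfolding dependent_over_functions_def by blast
qed

text \<open>The model space \<open>real^3\<close> expresses that the group has dimension 3. The
  level 0 contains the origin, which the linear action fixes, so it consists of the origin and the
  punctured cone, empty for definite \<open>A\<close>.\<close>

theorem proposition5p1:
  fixes A :: "real^3^3"
  assumes "transpose A = A" and "invertible A"
  shows "(\<exists>(G :: (real^3^3) monoid) (M :: (real^3^3, real^3) manifold)
            (\<rho> :: real^3^3 \<Rightarrow> real^3 \<Rightarrow> real^3) (\<gamma> :: 3 \<Rightarrow> real \<Rightarrow> real^3^3).
            lie_group G M \<and> smooth_action G M \<rho> \<and> lie_algebra_basis G M \<gamma> \<and>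
            (\<forall>i. fundamental_vector_field \<rho> (\<gamma> i) (quadric_field A i)) \<and>
            (\<forall>c. c \<noteq> 0 \<and> {p. quad A p = c} \<noteq> {} \<longrightarrow> {p. quad A p = c} \<in> orbits G UNIV \<rho>) \<and>
            {0} \<in> orbits G UNIV \<rho> \<and>
            ({p. quad A p = 0} - {0} \<noteq> {} \<longrightarrow> {p. quad A p = 0} - {0} \<in> orbits G UNIV \<rho>)) \<and>
         (\<forall>g :: real^3 \<Rightarrow> real. smooth_on UNIV g \<longrightarrow>
            commutator (quadric_field A 1) (quadric_field A 2) g = (\<lambda>p. \<Sum>k\<in>UNIV. A$3$k * derivation (quadric_field A k) g p) \<and>
            commutator (quadric_field A 2) (quadric_field A 3) g = (\<lambda>p. \<Sum>k\<in>UNIV. A$1$k * derivation (quadric_field A k) g p) \<and>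
            commutator (quadric_field A 3) (quadric_field A 1) g = (\<lambda>p. \<Sum>k\<in>UNIV. A$2$k * derivation (quadric_field A k) g p)) \<and>
         dependent_over_functions (quadric_field A) \<and>
         (\<forall>p. lin A 1 p *\<^sub>R quadric_field A 1 p + lin A 2 p *\<^sub>R quadric_field A 2 p + lin A 3 p *\<^sub>R quadric_field A 3 p = 0)"
proof (intro conjI)
  have A: "transpose A = A" "det A \<noteq> 0" using assms by (auto simp: invertible_det_nz)
  have "\<exists>\<gamma>. smooth_on UNIV \<gamma> \<and> \<gamma> 0 = mat 1 \<and>
      (\<forall>t. (\<gamma> has_vector_derivative (skew (axis i 1) ** A) ** \<gamma> t) (at t)) \<and>
      (\<forall>t. \<gamma> t \<in> isometries A) \<and> (\<forall>t u. \<gamma> (t + u) = \<gamma> t ** \<gamma> u)" for i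
    by (rule skew_mult_symmetric_flow[OF A(1), of "axis i 1"]) blast
  then obtain \<gamma> where \<gamma>: "\<And>i. smooth_on UNIV (\<gamma> i)" "\<And>i. \<gamma> i 0 = mat 1"
    "\<And>i t. (\<gamma> i has_vector_derivative (skew (axis i 1) ** A) ** \<gamma> i t) (at t)"
    "\<And>i t. \<gamma> i t \<in> isometries A" "\<And>i t u. \<gamma> i (t + u) = \<gamma> i t ** \<gamma> i u"
    by metis
  have "(\<gamma> i has_vector_derivative skew (axis i 1) ** A) (at 0)" for i
    using \<gamma>(3)[of i 0] by (simp add: \<gamma>(2))
  then have basis: "lie_algebra_basis (isometry_group A) (isometry_manifold A) \<gamma>"
    by (intro lie_algebra_basis_isometry_group A \<gamma>)
  have flow: "fundamental_vector_field (*v) (\<gamma> i) (quadric_field A i)" for i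
    unfolding fundamental_vector_field_def is_flow_of_def quadric_field_eq
  proof (intro conjI allI)
    show "\<gamma> i 0 *v p = p" for p by (simp add: \<gamma>(2))
    show "((\<lambda>s. \<gamma> i s *v p) has_vector_derivative skew (axis i 1) ** A *v (\<gamma> i t *v p)) (at t)" for p t
      using bounded_linear.has_vector_derivative[OF
          bounded_bilinear.bounded_linear_left[OF bounded_bilinear_matrix_vector_mult] \<gamma>(3)]
      by (simp add: matrix_vector_mul_assoc)
  qed
  have orbit: "{q. quad A q = quad A p} - {0} \<in> orbits (isometry_group A) UNIV (*v)" if "p \<noteq> 0" for p
    using isometry_orbit[OF A that] unfolding orbits_def by (auto simp: quad_eq_dot[OF A(1)])
  have q0: "quad A 0 = 0" by (simp add: quad_def)
  have "{p. quad A p = c} \<in> orbits (isometry_group A) UNIV (*v)" if c: "c \<noteq> 0" "{p. quad A p = c} \<noteq> {}" for c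
  proof -
    obtain p where p: "quad A p = c" using c(2) by blast
    \<comment> \<open>The origin lies on the level 0 only, so removing it changes no other
      level.\<close>
    have "p \<noteq> 0" "{q. quad A q = c} - {0} = {q. quad A q = c}" using p q0 c(1) by auto
    with orbit[of p] p show ?thesis by simp
  qed
  moreover have "{p. quad A p = 0} - {0} \<in> orbits (isometry_group A) UNIV (*v)"
    if "{p. quad A p = 0} - {0} \<noteq> {}"
  proof -
    obtain p where "quad A p = 0" "p \<noteq> 0" using \<open>{p. quad A p = 0} - {0} \<noteq> {}\<close> by blast
    with orbit[of p] show ?thesis by simp
  qed
  moreover have "{0} \<in> orbits (isometry_group A) UNIV (*v)"
    unfolding orbits_def using isometry_orbit_zero[of A] by auto
  ultimately show "\<exists>(G :: (real^3^3) monoid) (M :: (real^3^3, real^3) manifold)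
            (\<rho> :: real^3^3 \<Rightarrow> real^3 \<Rightarrow> real^3) (\<gamma> :: 3 \<Rightarrow> real \<Rightarrow> real^3^3).
            lie_group G M \<and> smooth_action G M \<rho> \<and> lie_algebra_basis G M \<gamma> \<and>
            (\<forall>i. fundamental_vector_field \<rho> (\<gamma> i) (quadric_field A i)) \<and>
            (\<forall>c. c \<noteq> 0 \<and> {p. quad A p = c} \<noteq> {} \<longrightarrow> {p. quad A p = c} \<in> orbits G UNIV \<rho>) \<and>
            {0} \<in> orbits G UNIV \<rho> \<and>
            ({p. quad A p = 0} - {0} \<noteq> {} \<longrightarrow> {p. quad A p = 0} - {0} \<in> orbits G UNIV \<rho>)"
    using lie_group_isometry_group[OF A] smooth_action_isometry_group[OF A] basis flow
    by (intro exI[of _ "isometry_group A"] exI[of _ "isometry_manifold A"] exI[of _ "(*v)"] exI[of _ \<gamma>]) blast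
  show "dependent_over_functions (quadric_field A)" by (rule dependent_quadric_fields[OF A(2)])
qed (use assms(1) in \<open>auto simp: commutator_quadric_fields quadric_fields_relation\<close>)

end
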